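(* The indecomposable projective module $P_1$ (with dimension vector $(1,1,2)$) is a central module and $\mu(P_1)$ is the minimal central measure. In particular, $\mu(P_1)$ has no direct predecessor.
   Context: Let $k$ be an algebraically closed field and $Q$ the quiver with vertices $1,2,3$, one arrow $1\to 2$ and two arrows $2\to 3$. A module is a finite-dimensional representation of $Q$ over $k$; its dimension vector is $(\dim M_1,\dim M_2,\dim M_3)$ and $|M|$ denotes its length. $P_1$ is the indecomposable projective module at vertex $1$. Order on subsets of $\mathbb{N}_1=\{1,2,3,\ldots\}$: for $I\ne J$ put $I<J$ if the smallest element of $(I\setminus J)\cup(J\setminus I)$ belongs to $J$. The Gabriel-Roiter measure $\mu(M)$ of a nonzero module $M$ is the maximum, in this order, of the sets $\{|M_1|,\ldots,|M_t|\}$ over all chains $M_1\subsetneq\cdots\subsetneq M_t$ of indecomposable submodules of $M$. A set is a Gabriel-Roiter measure if it equals $\mu(M)$ for some indecomposable $M$. By a theorem of Ringel there are Gabriel-Roiter measures $\mu_1<\mu_2<\mu_3<\cdots$ and $\cdots<\mu^3<\mu^2<\mu^1$ (infinitely many of each, with $\mu_i<\mu^j$ for all $i,j$) such that every other Gabriel-Roiter measure $\mu$ satisfies $\mu_i<\mu<\mu^j$ for all $i,j\ge 1$. The $\mu_i$ are called take-off measures, the $\mu^i$ landing measures, and all others central measures. An indecomposable module is a central module if its Gabriel-Roiter measure is a central measure. A Gabriel-Roiter measure $\mu$ is a direct predecessor of a Gabriel-Roiter measure $\mu'$ if $\mu<\mu'$ and there is no Gabriel-Roiter measure $\mu''$ with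 $\mu<\mu''<\mu'$. *)

theory Defs
  imports "HOL-Computational_Algebra.Computational_Algebra" "HOL-Library.Function_Algebras"
begin

section \<open>Representations of the quiver\<close>

datatype vertex = V1 | V2 | V3

datatype arrow = Alpha | Beta | Gamma

fun src :: "arrow \<Rightarrow> vertex" where
  "src Alpha = V1" | "src Beta = V2" | "src Gamma = V2"

fun tgt :: "arrow \<Rightarrow> vertex" where
  "tgt Alpha = V2" | "tgt Beta = V3" | "tgt Gamma = V3"

text \<open>
  The vector spaces of a representation are taken inside the infinite-dimensional space of all
  functions \<open>nat \<Rightarrow> 'k\<close>. Every finite-dimensional representation is isomorphic to
  one of this form, and submodules are again of this form.
\<close>

definition fscale :: "'k::field \<Rightarrow> (nat \<Rightarrow> 'k) \<Rightarrow> nat \<Rightarrow> 'k" where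
  "fscale c v = (\<lambda>i. c * v i)"

interpretation fvec: vector_space "fscale :: 'k::field \<Rightarrow> _"
  by unfold_locales (simp_all add: fscale_def fun_eq_iff distrib_left distrib_right mult.assoc)

record 'k rep =
  space :: "vertex \<Rightarrow> (nat \<Rightarrow> 'k) set"
  act :: "arrow \<Rightarrow> (nat \<Rightarrow> 'k) \<Rightarrow> (nat \<Rightarrow> 'k)"

definition fin_dim_subspace :: "(nat \<Rightarrow> 'k::field) set \<Rightarrow> bool" where
  "fin_dim_subspace U \<longleftrightarrow> (\<exists>B. finite B \<and> fvec.span B = U)"

definition linear_map :: "(nat \<Rightarrow> 'k::field) set \<Rightarrow> (nat \<Rightarrow> 'k) set \<Rightarrow> ((nat \<Rightarrow> 'k) \<Rightarrow> (nat \<Rightarrow> 'k)) \<Rightarrow> bool"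
  where
  "linear_map U W f \<longleftrightarrow>
     (\<forall>u\<in>U. f u \<in> W) \<and>
     (\<forall>u\<in>U. \<forall>v\<in>U. f (u + v) = f u + f v) \<and>
     (\<forall>c. \<forall>u\<in>U. f (fscale c u) = fscale c (f u))"

definition is_module :: "'k::field rep \<Rightarrow> bool" where
  "is_module M \<longleftrightarrow>
     (\<forall>x. fin_dim_subspace (space M x)) \<and>
     (\<forall>a. linear_map (space M (src a)) (space M (tgt a)) (act M a))"

definition nonzero :: "'k::field rep \<Rightarrow> bool" where
  "nonzero M \<longleftrightarrow> (\<exists>x. space M x \<noteq> {0})"

definition dim_vector :: "'k::field rep \<Rightarrow> nat \<times> nat \<times> nat" where
  "dim_vector M = (fvec.dim (space M V1), fvec.dim (space M V2), fvec.dim (space M V3))"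

text \<open>
  The value of \<open>act M a\<close> outside \<open>space M (src a)\<close> is irrelevant; a submodule keeps the map
  unchanged, so that the submodules of \<open>M\<close> correspond bijectively to the families of
  subspaces stable under the arrows.
\<close>

definition submodule :: "'k::field rep \<Rightarrow> 'k rep \<Rightarrow> bool" where
  "submodule N M \<longleftrightarrow> is_module N \<and> (\<forall>x. space N x \<subseteq> space M x) \<and> act N = act M"

definition proper_submodule :: "'k::field rep \<Rightarrow> 'k rep \<Rightarrow> bool" where
  "proper_submodule N M \<longleftrightarrow> submodule N M \<and> (\<exists>x. space N x \<noteq> space M x)"

definition direct_sum_of :: "'k::field rep \<Rightarrow> 'k rep \<Rightarrow> 'k rep \<Rightarrow> bool" where
  "direct_sum_of M N N' \<longleftrightarrow> submodule N M \<and> submodule N' M \<and>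
     (\<forall>x. space M x = {u + v | u v. u \<in> space N x \<and> v \<in> space N' x} \<and>
          space N x \<inter> space N' x = {0})"

definition indecomposable :: "'k::field rep \<Rightarrow> bool" where
  "indecomposable M \<longleftrightarrow> is_module M \<and> nonzero M \<and>
     \<not> (\<exists>N N'. direct_sum_of M N N' \<and> nonzero N \<and> nonzero N')"

definition module_hom :: "'k::field rep \<Rightarrow> 'k rep \<Rightarrow> (vertex \<Rightarrow> (nat \<Rightarrow> 'k) \<Rightarrow> (nat \<Rightarrow> 'k)) \<Rightarrow> bool" where
  "module_hom M N f \<longleftrightarrow>
     (\<forall>x. linear_map (space M x) (space N x) (f x)) \<and>
     (\<forall>a. \<forall>v\<in>space M (src a). f (tgt a) (act M a v) = act N a (f (src a) v))"

definition projective :: "'k::field rep \<Rightarrow> bool" where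
  "projective P \<longleftrightarrow> is_module P \<and>
     (\<forall>M N g f. is_module M \<longrightarrow> is_module N \<longrightarrow>
        module_hom M N g \<longrightarrow> (\<forall>x. g x ` space M x = space N x) \<longrightarrow> module_hom P N f \<longrightarrow>
        (\<exists>h. module_hom P M h \<and> (\<forall>x. \<forall>v\<in>space P x. g x (h x v) = f x v)))"

section \<open>Length and Gabriel-Roiter measure\<close>

definition submodule_chain :: "'k::field rep \<Rightarrow> 'k rep list \<Rightarrow> bool" where
  "submodule_chain M Ns \<longleftrightarrow> (\<forall>N\<in>set Ns. submodule N M) \<and> sorted_wrt proper_submodule Ns"

definition module_length :: "'k::field rep \<Rightarrow> nat" where
  "module_length M = Max {length Ns | Ns. submodule_chain M Ns \<and> (\<forall>N\<in>set Ns. nonzero N)}"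

definition gr_less :: "nat set \<Rightarrow> nat set \<Rightarrow> bool" where
  "gr_less I J \<longleftrightarrow> I \<noteq> J \<and> (LEAST n. n \<in> (I - J) \<union> (J - I)) \<in> J"

definition chain_length_sets :: "'k::field rep \<Rightarrow> nat set set" where
  "chain_length_sets M = {module_length ` set Ns | Ns.
     Ns \<noteq> [] \<and> submodule_chain M Ns \<and> (\<forall>N\<in>set Ns. indecomposable N)}"

definition gr_measure :: "'k::field rep \<Rightarrow> nat set" where
  "gr_measure M = (THE I. I \<in> chain_length_sets M \<and>
     (\<forall>J\<in>chain_length_sets M. J = I \<or> gr_less J I))"

definition gr_measures :: "'k::field itself \<Rightarrow> nat set set" where
  "gr_measures K = {gr_measure M | M :: 'k rep. indecomposable M}"

section \<open>Take-off, landing and central measures\<close>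

definition take_off_sequence :: "'k::field itself \<Rightarrow> (nat \<Rightarrow> nat set) \<Rightarrow> bool" where
  "take_off_sequence K lo \<longleftrightarrow>
     (\<forall>i. lo i \<in> gr_measures K \<and> gr_less (lo i) (lo (Suc i))) \<and>
     (\<forall>I\<in>gr_measures K. I \<notin> range lo \<longrightarrow> (\<forall>i. gr_less (lo i) I))"

definition landing_sequence :: "'k::field itself \<Rightarrow> (nat \<Rightarrow> nat set) \<Rightarrow> bool" where
  "landing_sequence K hi \<longleftrightarrow>
     (\<forall>i. hi i \<in> gr_measures K \<and> gr_less (hi (Suc i)) (hi i)) \<and>
     (\<forall>I\<in>gr_measures K. I \<notin> range hi \<longrightarrow> (\<forall>i. gr_less I (hi i)))"

definition take_off_measure :: "'k::field itself \<Rightarrow> nat set \<Rightarrow> bool" where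
  "take_off_measure K I \<longleftrightarrow> (\<exists>lo. take_off_sequence K lo \<and> I \<in> range lo)"

definition landing_measure :: "'k::field itself \<Rightarrow> nat set \<Rightarrow> bool" where
  "landing_measure K I \<longleftrightarrow> (\<exists>hi. landing_sequence K hi \<and> I \<in> range hi)"

definition central_measure :: "'k::field itself \<Rightarrow> nat set \<Rightarrow> bool" where
  "central_measure K I \<longleftrightarrow>
     I \<in> gr_measures K \<and> \<not> take_off_measure K I \<and> \<not> landing_measure K I"

definition central_module :: "'k::field rep \<Rightarrow> bool" where
  "central_module M \<longleftrightarrow> indecomposable M \<and> central_measure TYPE('k) (gr_measure M)"

definition direct_predecessor :: "'k::field itself \<Rightarrow> nat set \<Rightarrow> nat set \<Rightarrow> bool" where
  "direct_predecessor K I J \<longleftrightarrow> I \<in> gr_measures K \<and> J \<in> gr_measures K \<and> gr_less I J \<and>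
     \<not> (\<exists>L\<in>gr_measures K. gr_less I L \<and> gr_less L J)"

text \<open>
  Ringel's theorem provides both sequences at once, as in the following definition. Each of them
  is determined by the set of all measures, and \<open>central_measure_iff\<close> below shows that
  the definitions above agree with the description in terms of the two sequences.
\<close>

definition ringel_sequences ::
  "'k::field itself \<Rightarrow> (nat \<Rightarrow> nat set) \<Rightarrow> (nat \<Rightarrow> nat set) \<Rightarrow> bool" where
  "ringel_sequences K lo hi \<longleftrightarrow>
     (\<forall>i. lo i \<in> gr_measures K \<and> hi i \<in> gr_measures K) \<and>
     (\<forall>i. gr_less (lo i) (lo (Suc i)) \<and> gr_less (hi (Suc i)) (hi i)) \<and>
     (\<forall>i j. gr_less (lo i) (hi j)) \<and>
     (\<forall>I\<in>gr_measures K. I \<notin> range lo \<union> range hi \<longrightarrow>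
        (\<forall>i j. gr_less (lo i) I \<and> gr_less I (hi j)))"

lemma gr_less_iff: "gr_less I J \<longleftrightarrow> (\<exists>n\<in>J - I. \<forall>m<n. m \<in> I \<longleftrightarrow> m \<in> J)"
proof
  assume *: "gr_less I J"
  define P where "P = (\<lambda>n. n \<in> (I - J) \<union> (J - I))"
  have "\<exists>n. P n" and J: "Least P \<in> J"
    using * unfolding gr_less_def P_def by blast+
  hence "P (Least P)" by (metis LeastI)
  moreover have "\<forall>m<Least P. \<not> P m" using not_less_Least by blast
  ultimately show "\<exists>n\<in>J - I. \<forall>m<n. m \<in> I \<longleftrightarrow> m \<in> J"
    using J unfolding P_def by blast
next
  assume "\<exists>n\<in>J - I. \<forall>m<n. m \<in> I \<longleftrightarrow> m \<in> J"
  then obtain n where n: "n \<in> J - I" "\<forall>m<n. m \<in> I \<longleftrightarrow> m \<in> J" by blast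
  have "(LEAST m. m \<in> (I - J) \<union> (J - I)) = n"
  proof (rule Least_equality)
    show "n \<in> (I - J) \<union> (J - I)" using n by blast
    show "n \<le> m" if "m \<in> (I - J) \<union> (J - I)" for m
      using n(2) that by (meson DiffD1 DiffD2 UnE not_le)
  qed
  thus "gr_less I J" using n by (auto simp: gr_less_def)
qed

lemma gr_less_irrefl: "\<not> gr_less I I"
  by (simp add: gr_less_def)

lemma gr_less_trans:
  assumes "gr_less I J" "gr_less J L"
  shows "gr_less I L"
proof -
  obtain a where a: "a \<in> J - I" "\<forall>m<a. m \<in> I \<longleftrightarrow> m \<in> J"
    using assms(1) unfolding gr_less_iff by blast
  obtain b where b: "b \<in> L - J" "\<forall>m<b. m \<in> J \<longleftrightarrow> m \<in> L"
    using assms(2) unfolding gr_less_iff by blast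
  show ?thesis
  proof (cases "a < b")
    case True
    with a b show ?thesis unfolding gr_less_iff by (intro bexI[of _ a]) auto
  next
    case False
    with a b have "b < a" by (metis DiffD1 DiffD2 linorder_neqE_nat)
    with a b show ?thesis unfolding gr_less_iff by (intro bexI[of _ b]) auto
  qed
qed

text \<open>Uniqueness of an initial segment of order type \<open>\<omega>\<close>.\<close>

lemma initial_sequence_subset:
  fixes R :: "'a \<Rightarrow> 'a \<Rightarrow> bool" and s t :: "nat \<Rightarrow> 'a"
  assumes irr: "\<And>x. \<not> R x x" and tr: "\<And>x y z. R x y \<Longrightarrow> R y z \<Longrightarrow> R x z"
    and s: "\<And>i. s i \<in> G \<and> R (s i) (s (Suc i))" "\<And>x i. x \<in> G \<Longrightarrow> x \<notin> range s \<Longrightarrow> R (s i) x"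
    and t: "\<And>i. t i \<in> G \<and> R (t i) (t (Suc i))" "\<And>x i. x \<in> G \<Longrightarrow> x \<notin> range t \<Longrightarrow> R (t i) x"
  shows "range s \<subseteq> range t"
proof (rule ccontr)
  assume "\<not> range s \<subseteq> range t"
  then obtain i where i: "s i \<notin> range t" by blast
  have mono: "R (u m) (u n)" if u: "\<And>i. R (u i) (u (Suc i))" and "m < n" for u m n
    using \<open>m < n\<close>
  proof (induction n)
    case (Suc n)
    show ?case
    proof (cases "m = n")
      case True
      thus ?thesis using u by simp
    next
      case False
      with Suc.prems have "R (u m) (u n)" by (intro Suc.IH) simp
      thus ?thesis using u tr by blast
    qed
  qed simp
  have below: "R (t j) (s i)" for j using t(2) s(1) i by blast
  have "t j \<in> s ` {..<i}" for j
  proof -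
    have "t j \<in> range s"
    proof (rule ccontr)
      assume "t j \<notin> range s"
      hence "R (s i) (t j)" using s(2) t(1) by blast
      thus False using tr[OF below[of j]] irr by blast
    qed
    then obtain l where l: "t j = s l" by blast
    have "l < i"
    proof (rule ccontr)
      assume "\<not> l < i"
      hence "l = i \<or> i < l" by auto
      hence "l = i \<or> R (s i) (s l)" using mono[of s i l] s(1) by blast
      thus False
      proof
        assume "l = i"
        thus False using below[of j] l irr by simp
      next
        assume "R (s i) (s l)"
        thus False using tr[OF below[of j], of "s l"] l irr by simp
      qed
    qed
    thus ?thesis using l by blast
  qed
  hence "finite (range t)" by (meson finite_imageI finite_lessThan finite_subset image_subsetI)
  moreover have "inj t"
  proof (rule injI)
    fix m n assume "t m = t n"
    show "m = n"
    proof (rule linorder_cases)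
      assume "m < n"
      thus ?thesis using mono[of t m n] t(1) irr \<open>t m = t n\<close> by simp
    next
      assume "n < m"
      thus ?thesis using mono[of t n m] t(1) irr \<open>t m = t n\<close> by simp
    qed
  qed
  ultimately show False using finite_imageD by blast
qed

lemma take_off_sequence_range_unique:
  assumes "take_off_sequence K lo" "take_off_sequence K lo'"
  shows "range lo = range lo'"
proof -
  have "range s \<subseteq> range t" if "take_off_sequence K s" "take_off_sequence K t" for s t
  proof (rule initial_sequence_subset[where R = gr_less and G = "gr_measures K"])
    fix x y z
    show "\<not> gr_less x x" by (rule gr_less_irrefl)
    show "gr_less x z" if "gr_less x y" "gr_less y z" using gr_less_trans that by blast
  qed (use that in \<open>unfold take_off_sequence_def, blast+\<close>)
  thus ?thesis using assms by blast
qed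

lemma landing_sequence_range_unique:
  assumes "landing_sequence K hi" "landing_sequence K hi'"
  shows "range hi = range hi'"
proof -
  have "range s \<subseteq> range t" if "landing_sequence K s" "landing_sequence K t" for s t
  proof (rule initial_sequence_subset[where R = "\<lambda>x y. gr_less y x" and G = "gr_measures K"])
    fix x y z
    show "\<not> gr_less x x" by (rule gr_less_irrefl)
    show "gr_less z x" if "gr_less y x" "gr_less z y" using gr_less_trans that by blast
  qed (use that in \<open>unfold landing_sequence_def, blast+\<close>)
  thus ?thesis using assms by blast
qed

lemma central_measure_iff:
  assumes "ringel_sequences K lo hi"
  shows "central_measure K I \<longleftrightarrow> I \<in> gr_measures K \<and> I \<notin> range lo \<and> I \<notin> range hi"
proof -
  have G: "lo i \<in> gr_measures K" "hi i \<in> gr_measures K"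
    and step: "gr_less (lo i) (lo (Suc i))" "gr_less (hi (Suc i)) (hi i)"
    and less: "gr_less (lo i) (hi j)" for i j
    using assms unfolding ringel_sequences_def by simp_all
  have between: "gr_less (lo i) I \<and> gr_less I (hi j)"
    if "I \<in> gr_measures K" "I \<notin> range lo" "I \<notin> range hi" for I i j
    using assms that unfolding ringel_sequences_def by simp
  have "gr_less (lo i) I" if "I \<in> gr_measures K" "I \<notin> range lo" for I i
    using that between less by (cases "I \<in> range hi") auto
  hence lo: "take_off_sequence K lo"
    using G step unfolding take_off_sequence_def by simp
  have "gr_less I (hi i)" if "I \<in> gr_measures K" "I \<notin> range hi" for I i
    using that between less by (cases "I \<in> range lo") auto
  hence hi: "landing_sequence K hi"
    using G step unfolding landing_sequence_def by simp
  have "take_off_measure K I \<longleftrightarrow> I \<in> range lo"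
    unfolding take_off_measure_def using lo take_off_sequence_range_unique[OF lo] by blast
  moreover have "landing_measure K I \<longleftrightarrow> I \<in> range hi"
    unfolding landing_measure_def using hi landing_sequence_range_unique[OF hi] by blast
  ultimately show ?thesis
    by (simp add: central_measure_def)
qed

section \<open>The projective module at vertex 1\<close>

definition unit_vec :: "nat \<Rightarrow> nat \<Rightarrow> 'k::field" where
  "unit_vec i = (\<lambda>j. if j = i then 1 else 0)"

text \<open>
  The paths starting at vertex 1 form a basis of \<open>P\<^sub>1\<close>, and an arrow acts by prolonging paths.
  At vertices 1 and 2 the unique such path corresponds to \<open>unit_vec 0\<close>; at vertex 3 the paths
  ending with \<open>Beta\<close> and \<open>Gamma\<close> correspond to \<open>unit_vec 0\<close> and \<open>unit_vec 1\<close>. So \<open>Beta\<close>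
  acts as the identity and \<open>Gamma\<close> as the right shift.
\<close>

fun P1_space :: "vertex \<Rightarrow> (nat \<Rightarrow> 'k::field) set" where
  "P1_space V1 = fvec.span {unit_vec 0}"
| "P1_space V2 = fvec.span {unit_vec 0}"
| "P1_space V3 = fvec.span {unit_vec 0, unit_vec 1}"

fun P1_act :: "arrow \<Rightarrow> (nat \<Rightarrow> 'k::field) \<Rightarrow> (nat \<Rightarrow> 'k)" where
  "P1_act Alpha v = v"
| "P1_act Beta v = v"
| "P1_act Gamma v = (\<lambda>i. case i of 0 \<Rightarrow> 0 | Suc j \<Rightarrow> v j)"

definition P1 :: "'k::field rep" where
  "P1 = \<lparr>space = P1_space, act = P1_act\<rparr>"

end

theory Submission
  imports Defs
begin

text \<open>
  The measure of \<open>P1\<close> is \<open>{1, 3, 4}\<close>. An indecomposable module that is not simple contains an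
  indecomposable submodule of length 2, or a copy of \<open>P1\<close>, or it vanishes at vertex 1 and no
  nontrivial combination of the two remaining arrows kills a nonzero vector. In the first two cases
  its measure is at least \<open>{1, 3, 4}\<close>. In the third case it is a preprojective Kronecker module: the
  submodule formed by \<open>U = Beta(M\<^sub>2)\<close> and \<open>Gamma\<inverse>(U)\<close> is again indecomposable of the same kind, and
  proper because an endomorphism of a nonzero space over an algebraically closed field has an
  eigenvector, so induction gives dimensions \<open>(0, n, n + 1)\<close> and measure \<open>{1, 3, \<dots>, 2 n + 1}\<close>.
  These sets increase towards \<open>{1, 3, 4}\<close> without reaching it, hence they are the take-off measures.
  The regular Kronecker modules with dimensions \<open>(0, n, n)\<close> contain a submodule of length 2 and
  provide infinitely many measures above \<open>{1, 3, 4}\<close>, so this is not a landing measure.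
\<close>

text \<open>The order is decided by the least difference, so small elements count most: {1, 2} beats
  {1, 3, 4} at 2, while {1, 3, 5, ...} loses to it at 4. The numbers 1, 3, 4 are the lengths of
  modules with dimension vectors (0, 0, 1), (0, 1, 2) and (1, 1, 2). A lower bound for a measure
  takes a single chain, and modules generated by one element supply it: the generator spans the
  whole space at its own vertex, so no decomposition can divide it. An exact measure also needs a
  bound over all chains. It comes from heredity: absence of eigenvectors passes to submodules, so
  their indecomposable submodules again fall under the third case and have odd length. This is why
  the dimensions (0, n, n + 1) must be established for every module of that kind and not only for
  the standard examples. The landing measures are never computed: only finitely many measures can
  lie above one of them.\<close>

interpretation fvec_pair: vector_space_pair "fscale :: 'k::field \<Rightarrow> _" "fscale :: 'k \<Rightarrow> _" ..

section \<open>Linear algebra\<close>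

lemma fin_dim_subspace_imp_subspace: "fin_dim_subspace U \<Longrightarrow> fvec.subspace U"
  unfolding fin_dim_subspace_def by auto

lemma fin_dim_subspace_span: "finite B \<Longrightarrow> fin_dim_subspace (fvec.span B)"
  unfolding fin_dim_subspace_def by blast

lemma fin_dim_subspace_zero: "fin_dim_subspace {0 :: nat \<Rightarrow> 'k::field}"
  using fin_dim_subspace_span[of "{} :: (nat \<Rightarrow> 'k) set"] by simp

lemma finite_independent:
  assumes "fin_dim_subspace U" "B \<subseteq> U" "fvec.independent B"
  shows "finite B"
proof -
  obtain T where "finite T" "fvec.span T = U"
    using assms(1) unfolding fin_dim_subspace_def by blast
  thus ?thesis using fvec.independent_span_bound[of T B] assms(2,3) by simp
qed

lemma fin_dim_subspace_subset:
  assumes "fin_dim_subspace U" "fvec.subspace S" "S \<subseteq> U"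
  shows "fin_dim_subspace S"
proof -
  obtain B where B: "B \<subseteq> S" "fvec.independent B" "S \<subseteq> fvec.span B"
    using fvec.maximal_independent_subset by blast
  have "finite B" using finite_independent[OF assms(1)] B assms(3) by blast
  moreover have "fvec.span B = S" using B assms(2) by (simp add: fvec.span_subspace)
  ultimately show ?thesis unfolding fin_dim_subspace_def by blast
qed

lemma fin_dim_basis:
  assumes "fin_dim_subspace U"
  obtains B where "finite B" "fvec.independent B" "fvec.span B = U" "card B = fvec.dim U" "B \<subseteq> U"
proof -
  obtain B where B: "B \<subseteq> U" "fvec.independent B" "U \<subseteq> fvec.span B" "card B = fvec.dim U"
    using fvec.basis_exists by blast
  moreover have "finite B" using finite_independent[OF assms] B by blast
  moreover have "fvec.span B = U"
    using B fin_dim_subspace_imp_subspace[OF assms] by (simp add: fvec.span_subspace)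
  ultimately show ?thesis using that by blast
qed

lemma dim_subspace_mono:
  assumes "fin_dim_subspace U" "S \<subseteq> U"
  shows "fvec.dim S \<le> fvec.dim U"
proof -
  obtain B where B: "finite B" "fvec.independent B" "fvec.span B = U" "card B = fvec.dim U" "B \<subseteq> U"
    by (rule fin_dim_basis[OF assms(1)])
  thus ?thesis using assms(2) B fvec.dim_le_card[of S B] by simp
qed

lemma span_insert_span: "fvec.span (insert v (fvec.span B)) = fvec.span (insert v B)"
  by (simp add: fvec.span_insert fvec.span_span)

lemma dim_insert_span:
  assumes "fin_dim_subspace U" "v \<notin> U"
  shows "fvec.dim (fvec.span (insert v U)) = Suc (fvec.dim U)"
proof -
  obtain B where B: "finite B" "fvec.independent B" "fvec.span B = U" "card B = fvec.dim U" "B \<subseteq> U"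
    by (rule fin_dim_basis[OF assms(1)])
  have "fvec.independent (insert v B)"
    using B assms(2) by (simp add: fvec.independent_insertI)
  moreover have "fvec.span (insert v U) = fvec.span (insert v B)"
    unfolding B(3)[symmetric] by (rule span_insert_span)
  moreover have "v \<notin> B" using B(3) assms(2) fvec.span_base[of v B] by blast
  ultimately show ?thesis
    using B fvec.dim_span_eq_card_independent[of "insert v B"] by simp
qed

text \<open>Extend a basis of \<open>D\<close> by \<open>v\<close> and then to a basis of
  \<open>U\<close>; without \<open>v\<close> it spans \<open>C\<close>. The freedom in
  \<open>D\<close> makes it possible to split off the line through \<open>v\<close> while the
  complement keeps the images of all incoming arrows.\<close>

lemma subspace_hyperplane:
  assumes "fin_dim_subspace U" "fvec.subspace D" "D \<subseteq> U" "v \<in> U" "v \<notin> D"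
  obtains C where "fvec.subspace C" "D \<subseteq> C" "C \<subseteq> U" "v \<notin> C" "U = fvec.span (insert v C)"
proof -
  have "fin_dim_subspace D" using fin_dim_subspace_subset assms by blast
  then obtain A where A: "finite A" "fvec.independent A" "fvec.span A = D" "card A = fvec.dim D" "A \<subseteq> D"
    by (rule fin_dim_basis)
  have "fvec.independent (insert v A)"
    using A assms by (simp add: fvec.independent_insertI)
  moreover have "insert v A \<subseteq> U" using A assms fvec.span_base by blast
  ultimately obtain B where B: "insert v A \<subseteq> B" "B \<subseteq> U" "fvec.independent B" "U \<subseteq> fvec.span B"
    using fvec.maximal_independent_subset_extend by metis
  have subU: "fvec.subspace U" using assms(1) by (rule fin_dim_subspace_imp_subspace)
  have "v \<notin> A" using A assms(5) fvec.span_base by blast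
  show ?thesis
  proof (rule that)
    show "fvec.subspace (fvec.span (B - {v}))" by simp
    show "D \<subseteq> fvec.span (B - {v})"
      using A(3) B(1) \<open>v \<notin> A\<close> by (metis Diff_insert_absorb Diff_mono fvec.span_mono insertI1 insert_Diff order_refl)
    show "fvec.span (B - {v}) \<subseteq> U"
      using B(2) subU by (intro fvec.span_minimal) auto
    show "v \<notin> fvec.span (B - {v})"
      using B(1,3) unfolding fvec.dependent_def by blast
    have "fvec.span (insert v (fvec.span (B - {v}))) = fvec.span (insert v (B - {v}))"
      by (rule span_insert_span)
    also have "insert v (B - {v}) = B" using B(1) by blast
    also have "fvec.span B = U" using B subU by (simp add: fvec.span_subspace)
    finally show "U = fvec.span (insert v (fvec.span (B - {v})))" by simp
  qed
qed

lemma span_insert_subspace: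
  assumes "fvec.subspace C"
  shows "u \<in> fvec.span (insert v C) \<longleftrightarrow> (\<exists>k. u - fscale k v \<in> C)"
  unfolding fvec.span_breakdown_eq using assms by (simp add: fvec.span_eq_iff[THEN iffD2])

lemma subspace_eqI_dim:
  assumes "fin_dim_subspace U" "fvec.subspace S" "S \<subseteq> U" "fvec.dim U \<le> fvec.dim S"
  shows "S = U"
proof (rule ccontr)
  assume "S \<noteq> U"
  then obtain v where v: "v \<in> U" "v \<notin> S" using assms by blast
  have "fvec.span (insert v S) \<subseteq> U"
    using assms v fin_dim_subspace_imp_subspace by (intro fvec.span_minimal) auto
  hence "fvec.dim (fvec.span (insert v S)) \<le> fvec.dim U"
    using dim_subspace_mono assms(1) by blast
  moreover have "fin_dim_subspace S" using fin_dim_subspace_subset assms by blast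
  ultimately show False using dim_insert_span[of S v] v assms(4) by simp
qed

lemma dim_eq_0_subspace:
  assumes "fin_dim_subspace U" "fvec.dim U = 0"
  shows "U = {0}"
proof -
  obtain B where B: "finite B" "fvec.independent B" "fvec.span B = U" "card B = fvec.dim U" "B \<subseteq> U"
    by (rule fin_dim_basis[OF assms(1)])
  thus ?thesis using assms(2) B by auto
qed

text \<open>An arrow acts linearly only on its own space. An extension to all sequences, agreeing
  with \<open>f\<close> on a basis of \<open>U\<close>, gives access to the theory of linear maps
  between whole vector spaces.\<close>

lemma linear_map_extend:
  assumes "fvec.subspace U" "linear_map U W f"
  shows "\<exists>g. Vector_Spaces.linear fscale fscale g \<and> (\<forall>u\<in>U. g u = f u)"
proof -
  obtain B where B: "B \<subseteq> U" "fvec.independent B" "U \<subseteq> fvec.span B"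
    using fvec.maximal_independent_subset by blast
  obtain g where g: "Vector_Spaces.linear fscale fscale g" "\<forall>x\<in>B. g x = f x"
    using fvec_pair.linear_independent_extend[OF B(2)] by blast
  interpret g: Vector_Spaces.linear fscale fscale g by (rule g(1))
  have f: "f (u + v) = f u + f v" "f (fscale c u) = fscale c (f u)" if "u \<in> U" "v \<in> U" for u v c
    using assms(2) that unfolding linear_map_def by blast+
  have f0: "f 0 = 0"
    using f(2)[of 0 0 0] assms(1) by (simp add: fvec.subspace_0)
  have "fvec.subspace {u \<in> U. g u = f u}"
  proof (rule fvec.subspaceI)
    show "0 \<in> {u \<in> U. g u = f u}"
      using f0 fvec.subspace_0[OF assms(1)] g.zero by auto
    show "u + v \<in> {u \<in> U. g u = f u}" if "u \<in> {u \<in> U. g u = f u}" "v \<in> {u \<in> U. g u = f u}" for u v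
      using that f(1) fvec.subspace_add[OF assms(1)] g.add by auto
    show "fscale c u \<in> {u \<in> U. g u = f u}" if "u \<in> {u \<in> U. g u = f u}" for u c
      using that f(2) fvec.subspace_scale[OF assms(1)] g.scale by auto
  qed
  moreover have "B \<subseteq> {u \<in> U. g u = f u}" using B g(2) by blast
  ultimately have "fvec.span B \<subseteq> {u \<in> U. g u = f u}" by (rule fvec.span_minimal[rotated])
  thus ?thesis using g(1) B by blast
qed

lemma dim_image_inj_on:
  assumes "Vector_Spaces.linear fscale fscale f" "fin_dim_subspace U" "inj_on f U"
  shows "fvec.dim (f ` U) = fvec.dim U"
proof -
  interpret f: Vector_Spaces.linear fscale fscale f by (rule assms(1))
  obtain B where B: "finite B" "fvec.independent B" "fvec.span B = U" "card B = fvec.dim U" "B \<subseteq> U"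
    by (rule fin_dim_basis[OF assms(2)])
  have "fvec.independent (f ` B)"
    using f.independent_injective_image[OF B(2)] B(3) assms(3) by simp
  hence "fvec.dim (fvec.span (f ` B)) = card (f ` B)"
    by (rule fvec.dim_span_eq_card_independent)
  also have "card (f ` B) = card B"
    using assms(3) B(5) by (meson card_image inj_on_subset)
  finally show ?thesis using B by (simp add: f.span_image)
qed

lemma fin_dim_subspace_image:
  assumes "Vector_Spaces.linear fscale fscale f" "fin_dim_subspace U"
  shows "fin_dim_subspace (f ` U)"
proof -
  interpret f: Vector_Spaces.linear fscale fscale f by (rule assms(1))
  obtain T where "finite T" "fvec.span T = U"
    using assms(2) unfolding fin_dim_subspace_def by blast
  thus ?thesis using f.span_image[of T] fin_dim_subspace_span[of "f ` T"] by simp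
qed

section \<open>Eigenvectors: the value p(T) v, evaluated by Horner's rule\<close>

definition poly_act :: "((nat \<Rightarrow> 'k::field) \<Rightarrow> (nat \<Rightarrow> 'k)) \<Rightarrow> (nat \<Rightarrow> 'k) \<Rightarrow> 'k poly \<Rightarrow> (nat \<Rightarrow> 'k)" where
  "poly_act T v p = fold_coeffs (\<lambda>a w. fscale a v + T w) p 0"

context
  fixes T :: "(nat \<Rightarrow> 'k::field) \<Rightarrow> (nat \<Rightarrow> 'k)"
  assumes lin: "Vector_Spaces.linear fscale fscale T"
begin

interpretation T: Vector_Spaces.linear fscale fscale T by (rule lin)

lemma poly_act_0: "poly_act T v 0 = 0"
  by (simp add: poly_act_def)

lemma poly_act_pCons: "poly_act T v (pCons a p) = fscale a v + T (poly_act T v p)"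
proof (cases "a = 0 \<and> p = 0")
  case True
  hence "poly_act T v (pCons a p) = 0" by (simp add: poly_act_0)
  moreover have "fscale a v + T (poly_act T v p) = 0"
    using True by (simp add: poly_act_0 T.zero)
  ultimately show ?thesis by simp
next
  case False
  let ?f = "\<lambda>a w. fscale a v + T w"
  have "fold_coeffs ?f (pCons a p) = ?f a \<circ> fold_coeffs ?f p"
    using False fold_coeffs_pCons_coeff_not_0_eq[of a ?f p] fold_coeffs_pCons_not_0_0_eq[of p ?f a]
    by (cases "a = 0") auto
  thus ?thesis by (simp only: poly_act_def o_apply)
qed

lemma poly_act_add: "poly_act T v (p + q) = poly_act T v p + poly_act T v q"
proof (induction p q rule: poly_induct2)
  case 0
  then show ?case by (simp only: poly_act_0 add_0_left)
next
  case (pCons a p b q)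
  then show ?case
    by (simp only: add_pCons poly_act_pCons T.add fvec.scale_left_distrib ac_simps)
qed

lemma poly_act_smult: "poly_act T v (smult c p) = fscale c (poly_act T v p)"
proof (induction p)
  case 0
  then show ?case by (simp only: poly_act_0 smult_0_right fvec.scale_zero_right)
next
  case (pCons a p)
  then show ?case
    by (simp only: smult_pCons poly_act_pCons T.scale fvec.scale_right_distrib fvec.scale_scale)
qed

lemma poly_act_mult_linear:
  "poly_act T v ([:- c, 1:] * q) = T (poly_act T v q) - fscale c (poly_act T v q)"
proof -
  have "[:- c, 1:] * q = smult (- c) q + pCons 0 q"
    by (simp add: mult_pCons_left)
  hence "poly_act T v ([:- c, 1:] * q) = fscale (- c) (poly_act T v q) + (fscale 0 v + T (poly_act T v q))"
    by (simp only: poly_act_add poly_act_smult poly_act_pCons)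
  thus ?thesis
    by (simp only: fvec.scale_minus_left fvec.scale_zero_left add_0_left) (simp only: diff_conv_add_uminus add.commute)
qed

lemma poly_act_monom: "poly_act T v (monom c i) = fscale c ((T ^^ i) v)"
proof (induction i)
  case 0
  then show ?case
    by (simp only: monom_0 poly_act_pCons poly_act_0 T.zero add_0_right funpow_0)
next
  case (Suc i)
  then show ?case
    by (simp only: monom_Suc poly_act_pCons fvec.scale_zero_left add_0_left funpow.simps o_apply T.scale)
qed

lemma poly_act_sum: "poly_act T v (sum f A) = (\<Sum>x\<in>A. poly_act T v (f x))"
  by (induction A rule: infinite_finite_induct) (simp_all add: poly_act_0 poly_act_add)

lemma poly_act_in:
  assumes "fvec.subspace U" "T ` U \<subseteq> U" "v \<in> U"
  shows "poly_act T v p \<in> U"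
proof (induction p)
  case 0
  then show ?case using assms by (simp only: poly_act_0 fvec.subspace_0)
next
  case (pCons a p)
  hence "T (poly_act T v p) \<in> U" using assms by blast
  then show ?case unfolding poly_act_pCons
    by (rule fvec.subspace_add[OF assms(1) fvec.subspace_scale[OF assms(1,3)]])
qed

text \<open>Among the \<open>fvec.dim U + 1\<close> vectors obtained from \<open>v\<close> by
  applying \<open>T\<close> up to \<open>fvec.dim U\<close> times there is a linear relation; its
  coefficients form \<open>p\<close>.\<close>

lemma annihilating_poly_exists:
  assumes "fin_dim_subspace U" "T ` U \<subseteq> U" "v \<in> U"
  obtains p where "p \<noteq> 0" "poly_act T v p = 0"
proof -
  have inU: "(T ^^ i) v \<in> U" for i
    by (induction i) (use assms in auto)
  obtain n where n: "n = fvec.dim U" by blast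
  \<comment> \<open>Coinciding powers collapse to one element of a set, so linear dependence of the
    set would not detect them; a difference of two monomials serves in that case.\<close>
  show ?thesis
  proof (cases "inj_on (\<lambda>i. (T ^^ i) v) {..n}")
    case False
    then obtain i j where ij: "i \<noteq> j" "(T ^^ i) v = (T ^^ j) v" unfolding inj_on_def by blast
    have "coeff (monom 1 i + monom (- 1) j) i = (1 :: 'k)" using ij by simp
    hence "monom 1 i + monom (- 1) j \<noteq> (0 :: 'k poly)" by (metis coeff_0 zero_neq_one)
    moreover have "poly_act T v (monom 1 i + monom (- 1) j) = 0"
      by (simp only: poly_act_add poly_act_monom ij(2) fvec.scale_minus_left right_minus)
    ultimately show ?thesis using that by blast
  next
    case True
    let ?S = "(\<lambda>i. (T ^^ i) v) ` {..n}"
    have S: "finite ?S" "card ?S = Suc n" using True by (simp_all add: card_image)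
    have "?S \<subseteq> U" using inU by blast
    have "fvec.dependent ?S"
    proof (rule ccontr)
      assume "\<not> fvec.dependent ?S"
      hence "card ?S = fvec.dim ?S" by (metis fvec.dim_eq_card_independent)
      also have "\<dots> \<le> n" using dim_subspace_mono[OF assms(1) \<open>?S \<subseteq> U\<close>] n by simp
      finally show False using S by simp
    qed
    hence "\<exists>u. (\<exists>w\<in>?S. u w \<noteq> 0) \<and> (\<Sum>x\<in>?S. fscale (u x) x) = 0"
      by (rule iffD1[OF fvec.dependent_finite[OF S(1)]])
    then obtain u w where u: "w \<in> ?S" "u w \<noteq> 0" "(\<Sum>x\<in>?S. fscale (u x) x) = 0"
      by (elim exE conjE bexE)
    define p where "p = (\<Sum>i\<le>n. monom (u ((T ^^ i) v)) i)"
    have "poly_act T v p = (\<Sum>i\<le>n. fscale (u ((T ^^ i) v)) ((T ^^ i) v))"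
      unfolding p_def poly_act_sum poly_act_monom ..
    also have "\<dots> = (\<Sum>x\<in>?S. fscale (u x) x)"
      using True by (simp only: sum.reindex[OF True] o_def)
    also note u(3)
    finally have "poly_act T v p = 0" .
    moreover have "p \<noteq> 0"
    proof -
      obtain j where j: "j \<le> n" "w = (T ^^ j) v" using u(1) by blast
      have "coeff p j = u w"
        using j by (simp add: p_def coeff_sum)
      thus ?thesis using u(2) by auto
    qed
    ultimately show ?thesis using that by blast
  qed
qed

end

text \<open>Take an annihilating polynomial of least degree and split off a factor X - c at a root
  c. By minimality the cofactor does not annihilate \<open>v\<close>, and what it makes of
  \<open>v\<close> is killed by T - c.\<close>

lemma eigenvector_exists:
  fixes T :: "(nat \<Rightarrow> 'k::alg_closed_field) \<Rightarrow> (nat \<Rightarrow> 'k)"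
  assumes lin: "Vector_Spaces.linear fscale fscale T"
    and U: "fin_dim_subspace U" "T ` U \<subseteq> U" "v \<in> U" "v \<noteq> 0"
  obtains w c where "w \<in> U" "w \<noteq> 0" "T w = fscale c w"
proof -
  obtain p0 where "p0 \<noteq> 0 \<and> poly_act T v p0 = 0"
    using annihilating_poly_exists[OF lin U(1-3)] by blast
  then obtain p where p: "p \<noteq> 0" "poly_act T v p = 0"
    and min: "\<And>q. q \<noteq> 0 \<Longrightarrow> poly_act T v q = 0 \<Longrightarrow> degree p \<le> degree q"
    using ex_has_least_nat[of "\<lambda>p. p \<noteq> 0 \<and> poly_act T v p = 0" p0 degree] by metis
  have "degree p > 0"
  proof (rule ccontr)
    assume "\<not> degree p > 0"
    then obtain c where c: "p = [:c:]" using degree_0_id by (metis gr0I)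
    interpret T: Vector_Spaces.linear fscale fscale T by (rule lin)
    have "fscale c v = 0" using p(2) unfolding c
      by (simp only: poly_act_pCons[OF lin] poly_act_0[OF lin] T.zero add_0_right)
    thus False using p(1) U(4) c by (metis fvec.scale_eq_0_iff pCons_0_0)
  qed
  then obtain c where "poly p c = 0" using alg_closed_imp_poly_has_root by blast
  then obtain q where q: "p = [:- c, 1:] * q" by (metis poly_eq_0_iff_dvd dvdE)
  have q0: "q \<noteq> 0" using p(1) q by auto
  have "degree p = Suc (degree q)"
    unfolding q using q0 by (subst degree_mult_eq) auto
  hence "poly_act T v q \<noteq> 0" using min[OF q0] by auto
  moreover have "T (poly_act T v q) = fscale c (poly_act T v q)"
    using p(2) unfolding q poly_act_mult_linear[OF lin] by (metis eq_iff_diff_eq_0)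
  moreover have "poly_act T v q \<in> U"
    by (rule poly_act_in[OF lin fin_dim_subspace_imp_subspace[OF U(1)] U(2,3)])
  ultimately show ?thesis using that by blast
qed

section \<open>Submodules and length\<close>

lemma is_module_fin_dim: "is_module M \<Longrightarrow> fin_dim_subspace (space M x)"
  by (simp add: is_module_def)

lemma is_module_subspace: "is_module M \<Longrightarrow> fvec.subspace (space M x)"
  by (simp add: is_module_def fin_dim_subspace_imp_subspace)

lemma is_module_zero: "is_module M \<Longrightarrow> 0 \<in> space M x"
  by (simp only: is_module_subspace fvec.subspace_0)

lemma is_module_linear: "is_module M \<Longrightarrow> linear_map (space M (src a)) (space M (tgt a)) (act M a)"
  by (simp add: is_module_def)

lemma act_closed: "is_module M \<Longrightarrow> v \<in> space M (src a) \<Longrightarrow> act M a v \<in> space M (tgt a)"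
  using is_module_linear[of M a] by (simp add: linear_map_def)

lemma act_scale:
  "is_module M \<Longrightarrow> v \<in> space M (src a) \<Longrightarrow> act M a (fscale c v) = fscale c (act M a v)"
  using is_module_linear[of M a] by (simp only: linear_map_def)

lemma act_zero:
  assumes "is_module M" shows "act M a 0 = 0"
  using act_scale[OF assms is_module_zero[OF assms], of a 0] by (simp only: fvec.scale_zero_left)

lemma nonzero_iff:
  assumes "is_module M"
  shows "nonzero M \<longleftrightarrow> (\<exists>x. \<exists>v\<in>space M x. v \<noteq> 0)"
  using is_module_zero[OF assms] unfolding nonzero_def by (metis insertI1 singletonD subsetI subset_antisym subset_singletonD empty_iff)

lemma submodule_restrict:
  assumes "is_module M" "\<And>x. fvec.subspace (S x)" "\<And>x. S x \<subseteq> space M x"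
    and "\<And>a v. v \<in> S (src a) \<Longrightarrow> act M a v \<in> S (tgt a)"
  shows "submodule (M\<lparr>space := S\<rparr>) M"
proof -
  have "fin_dim_subspace (S x)" for x
    using fin_dim_subspace_subset[OF is_module_fin_dim[OF assms(1)] assms(2,3)] .
  moreover have "linear_map (S (src a)) (S (tgt a)) (act M a)" for a
    using is_module_linear[OF assms(1), of a] assms(3,4) unfolding linear_map_def by blast
  ultimately show ?thesis using assms(3) by (simp add: submodule_def is_module_def)
qed

lemma submodule_refl: "is_module M \<Longrightarrow> submodule M M"
  by (simp add: submodule_def)

lemma submodule_trans: "submodule K N \<Longrightarrow> submodule N M \<Longrightarrow> submodule K M"
  unfolding submodule_def by (metis subset_trans)

lemma submodule_is_module: "submodule N M \<Longrightarrow> is_module N"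
  by (simp add: submodule_def)

lemma submodule_subset: "submodule N M \<Longrightarrow> space N x \<subseteq> space M x"
  by (simp add: submodule_def)

lemma submodule_act: "submodule N M \<Longrightarrow> act N = act M"
  by (simp add: submodule_def)

lemma proper_submodule_iff: "proper_submodule N M \<longleftrightarrow> submodule N M \<and> N \<noteq> M"
proof
  assume "submodule N M \<and> N \<noteq> M"
  moreover from this have "space N \<noteq> space M"
    by (metis submodule_act old.unit.exhaust rep.equality)
  ultimately show "proper_submodule N M" unfolding proper_submodule_def by auto
qed (auto simp: proper_submodule_def)

section \<open>Total dimension and its agreement with the length\<close>

definition total_dim :: "'k::field rep \<Rightarrow> nat" where
  "total_dim M = fvec.dim (space M V1) + fvec.dim (space M V2) + fvec.dim (space M V3)"

lemma dim_submodule_le: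
  assumes "submodule N M" "is_module M"
  shows "fvec.dim (space N x) \<le> fvec.dim (space M x)"
  using dim_subspace_mono[OF is_module_fin_dim[OF assms(2)] submodule_subset[OF assms(1)]] .

lemma total_dim_submodule_le:
  assumes "submodule N M" "is_module M"
  shows "total_dim N \<le> total_dim M"
  unfolding total_dim_def using dim_submodule_le[OF assms] by (intro add_mono) auto

lemma total_dim_proper_submodule:
  assumes "proper_submodule N M" "is_module M"
  shows "total_dim N < total_dim M"
proof (rule ccontr)
  assume *: "\<not> ?thesis"
  have N: "submodule N M" using assms(1) by (simp add: proper_submodule_iff)
  have "fvec.dim (space N x) = fvec.dim (space M x)" for x
    using * dim_submodule_le[OF N assms(2), of V1] dim_submodule_le[OF N assms(2), of V2]
      dim_submodule_le[OF N assms(2), of V3]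
    unfolding total_dim_def by (cases x) auto
  hence "space N x = space M x" for x
    using subspace_eqI_dim[OF is_module_fin_dim[OF assms(2)] is_module_subspace submodule_subset[OF N]]
      submodule_is_module[OF N] by (metis order_refl)
  thus False using assms(1) unfolding proper_submodule_def by blast
qed

lemma total_dim_eq_0:
  assumes "is_module M"
  shows "total_dim M = 0 \<longleftrightarrow> \<not> nonzero M"
proof
  assume "total_dim M = 0"
  hence "fvec.dim (space M x) = 0" for x by (cases x) (simp_all add: total_dim_def)
  hence "space M x = {0}" for x
    by (rule dim_eq_0_subspace[OF is_module_fin_dim[OF assms]])
  thus "\<not> nonzero M" unfolding nonzero_def by blast
next
  assume "\<not> nonzero M"
  hence "space M x = fvec.span {}" for x unfolding nonzero_def by simp
  hence "fvec.dim (space M x) = 0" for x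
    using fvec.dim_span_eq_card_independent[OF fvec.independent_empty] by simp
  thus "total_dim M = 0" by (simp add: total_dim_def)
qed

text \<open>At the first vertex with a nonzero space no nonzero vector arrives along an arrow, so
  that space can be replaced by any of its hyperplanes.\<close>

lemma maximal_submodule_exists:
  assumes "is_module M" "nonzero M"
  obtains N where "submodule N M" "total_dim M = Suc (total_dim N)"
proof -
  have "\<exists>x. space M x \<noteq> {0} \<and> (\<forall>a. tgt a = x \<longrightarrow> space M (src a) = {0})"
  proof (cases "space M V1 = {0}")
    case False
    moreover have "tgt a \<noteq> V1" for a by (cases a) auto
    ultimately show ?thesis by blast
  next
    case V1: True
    show ?thesis
    proof (cases "space M V2 = {0}")
      case False
      moreover have "space M (src a) = {0}" if "tgt a = V2" for a using that V1 by (cases a) auto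
      ultimately show ?thesis by blast
    next
      case True
      hence "space M V3 \<noteq> {0}" using V1 assms(2) unfolding nonzero_def by (metis vertex.exhaust)
      moreover have "space M (src a) = {0}" for a using True V1 by (cases a) auto
      ultimately show ?thesis by blast
    qed
  qed
  then obtain x where x: "space M x \<noteq> {0}" "\<And>a. tgt a = x \<Longrightarrow> space M (src a) = {0}" by blast
  obtain v where v: "v \<in> space M x" "v \<notin> {0}"
    using x(1) is_module_zero[OF assms(1), of x] by auto
  obtain C where C: "fvec.subspace C" "{0} \<subseteq> C" "C \<subseteq> space M x" "v \<notin> C"
      "space M x = fvec.span (insert v C)"
    using subspace_hyperplane[OF is_module_fin_dim[OF assms(1)] fvec.subspace_single_0 _ v]
      is_module_zero[OF assms(1), of x] by auto
  let ?N = "M\<lparr>space := (space M)(x := C)\<rparr>"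
  have "submodule ?N M"
  proof (rule submodule_restrict[OF assms(1)])
    show "fvec.subspace (((space M)(x := C)) y)" for y
      using C(1) is_module_subspace[OF assms(1)] by auto
    show "((space M)(x := C)) y \<subseteq> space M y" for y using C(3) by auto
    show "act M a w \<in> ((space M)(x := C)) (tgt a)" if "w \<in> ((space M)(x := C)) (src a)" for a w
    proof (cases "tgt a = x")
      case True
      have "w \<in> space M (src a)" using that C(3) by (auto split: if_splits)
      hence "w = 0" using x(2)[OF True] by simp
      thus ?thesis using True act_zero[OF assms(1)] fvec.subspace_0[OF C(1)] by simp
    next
      case False
      have "w \<in> space M (src a)" using that C(3) by (auto split: if_splits)
      thus ?thesis using False act_closed[OF assms(1)] by simp
    qed
  qed
  moreover have "fvec.dim (space M x) = Suc (fvec.dim C)"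
    unfolding C(5) using dim_insert_span[OF fin_dim_subspace_subset[OF is_module_fin_dim[OF assms(1)] C(1,3)] C(4)] .
  hence "total_dim M = Suc (total_dim ?N)" by (cases x) (simp_all add: total_dim_def)
  ultimately show ?thesis using that by blast
qed

lemma submodule_chain_append:
  assumes "submodule_chain M Ns" "is_module M" "M \<notin> set Ns"
  shows "submodule_chain M (Ns @ [M])"
  using assms submodule_refl[OF assms(2)]
  unfolding submodule_chain_def by (auto simp: sorted_wrt_append proper_submodule_iff)

lemma submodule_chain_mono:
  "submodule_chain N Ns \<Longrightarrow> submodule N M \<Longrightarrow> submodule_chain M Ns"
  unfolding submodule_chain_def using submodule_trans by blast

lemma submodule_chain_full:
  assumes "is_module M"
  shows "\<exists>Ns. submodule_chain M Ns \<and> (\<forall>N\<in>set Ns. nonzero N) \<and> length Ns = total_dim M"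
  using assms
proof (induction "total_dim M" arbitrary: M)
  case 0
  then show ?case by (intro exI[of _ "[]"]) (simp add: submodule_chain_def)
next
  case (Suc d)
  have "nonzero M" using total_dim_eq_0[OF Suc.prems] Suc.hyps(2) by auto
  obtain N where N: "submodule N M" "total_dim M = Suc (total_dim N)"
    using maximal_submodule_exists[OF Suc.prems \<open>nonzero M\<close>] .
  have "d = total_dim N" using N(2) Suc.hyps(2) by simp
  then obtain Ns where Ns: "submodule_chain N Ns" "\<forall>N\<in>set Ns. nonzero N" "length Ns = total_dim N"
    using Suc.hyps(1)[OF _ submodule_is_module[OF N(1)]] by auto
  have "M \<notin> set Ns"
  proof
    assume "M \<in> set Ns"
    hence "submodule M N" using Ns(1) by (simp add: submodule_chain_def)
    thus False using total_dim_submodule_le[OF _ submodule_is_module[OF N(1)]] N(2) by fastforce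
  qed
  hence "submodule_chain M (Ns @ [M])"
    using submodule_chain_append[OF submodule_chain_mono[OF Ns(1) N(1)] Suc.prems] by simp
  thus ?case using Ns \<open>nonzero M\<close> N(2) by (intro exI[of _ "Ns @ [M]"]) auto
qed

text \<open>From here on lengths are computed as dimensions. Along a chain of nonzero submodules the
  total dimensions are distinct numbers in \<open>{1..total_dim M}\<close>; repeatedly taking
  maximal submodules attains the bound.\<close>

lemma module_length_eq:
  assumes "is_module M"
  shows "module_length M = total_dim M"
proof -
  let ?L = "{length Ns | Ns. submodule_chain M Ns \<and> (\<forall>N\<in>set Ns. nonzero N)}"
  have le: "n \<le> total_dim M" if n: "n \<in> ?L" for n
  proof -
    obtain Ns where Ns: "n = length Ns" "submodule_chain M Ns" "\<forall>N\<in>set Ns. nonzero N" using n by blast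
    have sub: "submodule N M" if "N \<in> set Ns" for N
      using Ns(2) that by (simp add: submodule_chain_def)
    have "sorted_wrt (\<lambda>N N'. total_dim N < total_dim N') Ns"
      using Ns(2) unfolding submodule_chain_def
      by (elim conjE, elim sorted_wrt_mono_rel[rotated])
         (use total_dim_proper_submodule submodule_is_module in blast)
    hence "sorted_wrt (<) (map total_dim Ns)" by (simp add: sorted_wrt_map)
    hence "distinct (map total_dim Ns)" by (simp add: strict_sorted_iff)
    hence "n = card (set (map total_dim Ns))" unfolding Ns(1) by (metis distinct_card length_map)
    also have "\<dots> \<le> card {1..total_dim M}"
    proof (rule card_mono)
      show "set (map total_dim Ns) \<subseteq> {1..total_dim M}"
      proof
        fix m assume "m \<in> set (map total_dim Ns)"
        then obtain N where N: "N \<in> set Ns" "m = total_dim N" by auto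
        have "m \<noteq> 0" using N Ns(3) total_dim_eq_0[OF submodule_is_module[OF sub[OF N(1)]]] by simp
        thus "m \<in> {1..total_dim M}"
          using N(2) total_dim_submodule_le[OF sub[OF N(1)] assms] by simp
      qed
    qed simp
    finally show ?thesis by simp
  qed
  hence "?L \<subseteq> {..total_dim M}" by auto
  hence "finite ?L" by (rule finite_subset) simp
  moreover have "total_dim M \<in> ?L" using submodule_chain_full[OF assms] by force
  ultimately show ?thesis unfolding module_length_def using le by (intro Max_eqI) auto
qed

section \<open>The Gabriel-Roiter measure of an indecomposable module\<close>

lemma gr_less_subset: "I \<subset> J \<Longrightarrow> gr_less I J"
proof -
  assume "I \<subset> J"
  hence "\<exists>n. n \<in> (I - J) \<union> (J - I)" by blast
  hence "(LEAST n. n \<in> (I - J) \<union> (J - I)) \<in> (I - J) \<union> (J - I)" by (rule LeastI_ex)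
  with \<open>I \<subset> J\<close> show ?thesis unfolding gr_less_def by blast
qed

lemma gr_less_linear: "I = J \<or> gr_less I J \<or> gr_less J I"
proof (cases "I = J")
  case False
  hence "\<exists>n. n \<in> (I - J) \<union> (J - I)" by blast
  hence "(LEAST n. n \<in> (I - J) \<union> (J - I)) \<in> (I - J) \<union> (J - I)" by (rule LeastI_ex)
  with False show ?thesis unfolding gr_less_def by (metis DiffD1 UnE Un_commute)
qed simp

lemma gr_greatest_exists:
  assumes "finite \<F>" "\<F> \<noteq> {}"
  shows "\<exists>I\<in>\<F>. \<forall>J\<in>\<F>. J = I \<or> gr_less J I"
  using assms
proof (induction \<F> rule: finite_ne_induct)
  case (insert A \<F>)
  then obtain I where I: "I \<in> \<F>" "\<forall>J\<in>\<F>. J = I \<or> gr_less J I" by blast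
  show ?case
  proof (cases "gr_less I A")
    case True
    hence "\<forall>J\<in>insert A \<F>. J = A \<or> gr_less J A" using I(2) gr_less_trans[of _ I A] by auto
    then show ?thesis by blast
  next
    case False
    hence "\<forall>J\<in>insert A \<F>. J = I \<or> gr_less J I" using I(2) gr_less_linear[of A I] by auto
    then show ?thesis using I(1) by blast
  qed
qed simp

lemma indecomposable_is_module: "indecomposable M \<Longrightarrow> is_module M"
  by (simp add: indecomposable_def)

lemma chain_length_setsI:
  assumes "Ns \<noteq> []" "submodule_chain M Ns" "\<And>N. N \<in> set Ns \<Longrightarrow> indecomposable N"
  shows "total_dim ` set Ns \<in> chain_length_sets M"
proof -
  have "module_length ` set Ns = total_dim ` set Ns"
    using assms(3) module_length_eq indecomposable_is_module by (intro image_cong) auto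
  thus ?thesis unfolding chain_length_sets_def using assms by blast
qed

lemma chain_length_setsE:
  assumes "J \<in> chain_length_sets M"
  obtains Ns where "Ns \<noteq> []" "submodule_chain M Ns" "\<And>N. N \<in> set Ns \<Longrightarrow> indecomposable N"
    "J = total_dim ` set Ns"
proof -
  obtain Ns where Ns: "Ns \<noteq> []" "submodule_chain M Ns" "\<forall>N\<in>set Ns. indecomposable N"
    "J = module_length ` set Ns"
    using assms unfolding chain_length_sets_def by blast
  moreover have "module_length ` set Ns = total_dim ` set Ns"
    using Ns(3) module_length_eq indecomposable_is_module by (intro image_cong) auto
  ultimately show ?thesis using that by metis
qed

lemma chain_length_sets_elem:
  assumes "J \<in> chain_length_sets M" "n \<in> J"
  obtains N where "submodule N M" "indecomposable N" "n = total_dim N"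
  using assms by (elim chain_length_setsE) (auto simp: submodule_chain_def)

lemma chain_length_sets_singleton:
  assumes "indecomposable M"
  shows "{total_dim M} \<in> chain_length_sets M"
  using chain_length_setsI[of "[M]" M] assms submodule_refl[OF indecomposable_is_module[OF assms]]
  by (simp add: submodule_chain_def)

lemma chain_length_sets_insert:
  assumes "J \<in> chain_length_sets N" "submodule N M" "indecomposable M" "N \<noteq> M"
  shows "insert (total_dim M) J \<in> chain_length_sets M"
proof -
  obtain Ns where Ns: "Ns \<noteq> []" "submodule_chain N Ns" "\<And>K. K \<in> set Ns \<Longrightarrow> indecomposable K"
    "J = total_dim ` set Ns" using assms(1) by (rule chain_length_setsE) blast
  have M: "is_module M" using assms(3) by (rule indecomposable_is_module)
  have "M \<notin> set Ns"
  proof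
    assume "M \<in> set Ns"
    hence "submodule M N" using Ns(2) by (simp add: submodule_chain_def)
    hence "total_dim M \<le> total_dim N"
      by (rule total_dim_submodule_le[OF _ submodule_is_module[OF assms(2)]])
    thus False using total_dim_proper_submodule[of N M] M assms(2,4) by (simp add: proper_submodule_iff)
  qed
  hence "submodule_chain M (Ns @ [M])"
    using submodule_chain_append[OF submodule_chain_mono[OF Ns(2) assms(2)] M] by simp
  hence "total_dim ` set (Ns @ [M]) \<in> chain_length_sets M"
    using Ns(3) assms(3) by (intro chain_length_setsI) auto
  thus ?thesis using Ns(4) by simp
qed

lemma chain_length_sets_mono:
  "submodule N M \<Longrightarrow> J \<in> chain_length_sets N \<Longrightarrow> J \<in> chain_length_sets M"
  unfolding chain_length_sets_def using submodule_chain_mono by blast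

lemma gr_measure_greatest:
  assumes "indecomposable M"
  shows "gr_measure M \<in> chain_length_sets M"
    and "J \<in> chain_length_sets M \<Longrightarrow> J = gr_measure M \<or> gr_less J (gr_measure M)"
proof -
  have M: "is_module M" using assms by (rule indecomposable_is_module)
  have "n \<le> total_dim M" if "J \<in> chain_length_sets M" "n \<in> J" for J n
    using that total_dim_submodule_le[OF _ M] by (metis chain_length_sets_elem)
  hence "chain_length_sets M \<subseteq> Pow {..total_dim M}" by blast
  hence "finite (chain_length_sets M)" by (rule finite_subset) simp
  then obtain I where I: "I \<in> chain_length_sets M" "\<forall>J\<in>chain_length_sets M. J = I \<or> gr_less J I"
    using gr_greatest_exists chain_length_sets_singleton[OF assms] by blast
  have "gr_measure M = I" unfolding gr_measure_def
  proof (rule the_equality)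
    show "K = I" if "K \<in> chain_length_sets M \<and> (\<forall>J\<in>chain_length_sets M. J = K \<or> gr_less J K)" for K
      using that I gr_less_trans[of K I K] gr_less_irrefl[of K] by blast
  qed (use I in blast)
  thus "gr_measure M \<in> chain_length_sets M"
    and "J \<in> chain_length_sets M \<Longrightarrow> J = gr_measure M \<or> gr_less J (gr_measure M)"
    using I by blast+
qed

text \<open>A proper subset is always smaller in the order, so a set coming from a chain and
  containing all competitors is the maximum. Every exact measure below is obtained this way.\<close>

lemma gr_measure_eqI:
  assumes "indecomposable M" "I \<in> chain_length_sets M" "\<And>J. J \<in> chain_length_sets M \<Longrightarrow> J \<subseteq> I"
  shows "gr_measure M = I"
proof (rule ccontr)
  assume neq: "gr_measure M \<noteq> I"
  have "gr_measure M \<subset> I"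
    using assms(3)[OF gr_measure_greatest(1)[OF assms(1)]] neq by blast
  moreover have "gr_less I (gr_measure M)"
    using gr_measure_greatest(2)[OF assms(1,2)] neq by simp
  ultimately show False using gr_less_subset gr_less_trans gr_less_irrefl by metis
qed

text \<open>Otherwise \<open>M\<close> could be appended to an optimal chain, giving a proper
  superset and hence a larger set.\<close>

lemma total_dim_in_gr_measure:
  assumes "indecomposable M"
  shows "total_dim M \<in> gr_measure M"
proof (rule ccontr)
  assume *: "total_dim M \<notin> gr_measure M"
  have M: "is_module M" using assms by (rule indecomposable_is_module)
  obtain Ns where Ns: "Ns \<noteq> []" "submodule_chain M Ns" "\<And>K. K \<in> set Ns \<Longrightarrow> indecomposable K"
    "gr_measure M = total_dim ` set Ns"
    using gr_measure_greatest(1)[OF assms] by (rule chain_length_setsE) blast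
  have "submodule_chain M (Ns @ [M])"
    using * Ns(4) by (intro submodule_chain_append[OF Ns(2) M]) auto
  hence "total_dim ` set (Ns @ [M]) \<in> chain_length_sets M"
    using Ns(3) assms by (intro chain_length_setsI) auto
  hence "insert (total_dim M) (gr_measure M) \<in> chain_length_sets M" using Ns(4) by simp
  moreover have "gr_less (gr_measure M) (insert (total_dim M) (gr_measure M))"
    using * by (intro gr_less_subset) auto
  ultimately show False
    using gr_measure_greatest(2)[OF assms] gr_less_trans gr_less_irrefl by metis
qed

section \<open>Submodules generated by one element\<close>

text \<open>The line through \<open>v\<close> at \<open>x\<close> is a direct summand, with complement a hyperplane containing \<open>D\<close>.\<close>

lemma split_simple:
  assumes "indecomposable M" "v \<in> space M x" "\<And>a. src a = x \<Longrightarrow> act M a v = 0"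
    and D: "fvec.subspace D" "D \<subseteq> space M x" "v \<notin> D"
    and "\<And>a u. tgt a = x \<Longrightarrow> u \<in> space M (src a) \<Longrightarrow> act M a u \<in> D"
  shows "total_dim M = 1"
proof -
  have M: "is_module M" using assms(1) by (rule indecomposable_is_module)
  obtain C where C: "fvec.subspace C" "D \<subseteq> C" "C \<subseteq> space M x" "v \<notin> C"
    "space M x = fvec.span (insert v C)"
    using subspace_hyperplane[OF is_module_fin_dim[OF M] D(1,2) assms(2) D(3)] .
  define S where "S = (\<lambda>y. if y = x then fvec.span {v} else {0})"
  let ?S' = "(space M)(x := C)"
  have Sx: "fvec.subspace (S y)" "S y \<subseteq> space M y" for y
    using fvec.span_minimal[of "{v}" "space M x"] assms(2) is_module_subspace[OF M] is_module_zero[OF M]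
    by (simp_all add: S_def)
  have src_tgt: "src a \<noteq> tgt a" for a by (cases a) auto
  have N: "submodule (M\<lparr>space := S\<rparr>) M"
  proof (rule submodule_restrict[OF M Sx])
    show "act M a u \<in> S (tgt a)" if u: "u \<in> S (src a)" for a u
    proof -
      have "act M a u = 0"
      proof (cases "src a = x")
        case True
        then obtain k where "u = fscale k v" using u by (auto simp: S_def fvec.span_singleton)
        moreover have "act M a (fscale k v) = fscale k (act M a v)"
          using act_scale[OF M, of v a] True assms(2) by simp
        ultimately show ?thesis using assms(3)[OF True] by (simp only: fvec.scale_zero_right)
      next
        case False
        hence "u = 0" using u by (simp add: S_def)
        thus ?thesis using act_zero[OF M] by simp
      qed
      thus ?thesis using fvec.subspace_0[OF Sx(1)] by simp
    qed
  qed
  have N': "submodule (M\<lparr>space := ?S'\<rparr>) M"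
  proof (rule submodule_restrict[OF M])
    show "fvec.subspace (?S' y)" for y using C(1) is_module_subspace[OF M] by auto
    show "?S' y \<subseteq> space M y" for y using C(3) by auto
    show "act M a u \<in> ?S' (tgt a)" if "u \<in> ?S' (src a)" for a u
    proof -
      have u: "u \<in> space M (src a)" using that C(3) by (auto split: if_splits)
      show ?thesis using assms(7)[OF _ u] act_closed[OF M u] C(2) by auto
    qed
  qed
  have "v \<noteq> 0" using C(1,4) fvec.subspace_0 by blast
  have "direct_sum_of M (M\<lparr>space := S\<rparr>) (M\<lparr>space := ?S'\<rparr>)"
    unfolding direct_sum_of_def
  proof (intro conjI allI N N')
    fix y
    show "space M y = {u + w |u w. u \<in> space (M\<lparr>space := S\<rparr>) y \<and> w \<in> space (M\<lparr>space := ?S'\<rparr>) y}"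
    proof (cases "y = x")
      case True
      have "fvec.span (insert v C) = {u + w |u w. u \<in> fvec.span {v} \<and> w \<in> fvec.span C}"
        using fvec.span_Un[of "{v}" C] by simp
      moreover have "fvec.span C = C" using C(1) by simp
      ultimately show ?thesis using True C(5) by (simp add: S_def)
    next
      case False
      thus ?thesis by (simp add: S_def)
    qed
    show "space (M\<lparr>space := S\<rparr>) y \<inter> space (M\<lparr>space := ?S'\<rparr>) y = {0}"
    proof (cases "y = x")
      case True
      have "u = 0" if u: "u \<in> fvec.span {v}" "u \<in> C" for u
      proof -
        obtain k where k: "u = fscale k v" using u(1) by (auto simp: fvec.span_singleton)
        show ?thesis
        proof (cases "k = 0")
          case True
          thus ?thesis using k by (simp only: fvec.scale_zero_left)
        next
          case False
          have "fscale (inverse k) u \<in> C" using u(2) C(1) by (simp add: fvec.subspace_scale)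
          hence "v \<in> C" unfolding k using False by (simp add: fvec.scale_scale)
          thus ?thesis using C(4) by blast
        qed
      qed
      thus ?thesis using True fvec.subspace_0[OF C(1)] fvec.span_zero[of "{v}"]
        by (auto simp: S_def)
    next
      case False
      thus ?thesis using is_module_zero[OF M, of y] by (auto simp: S_def)
    qed
  qed
  moreover have "nonzero (M\<lparr>space := S\<rparr>)"
    unfolding nonzero_iff[OF submodule_is_module[OF N]]
    by (intro exI[of _ x] bexI[of _ v]) (simp_all add: S_def \<open>v \<noteq> 0\<close> fvec.span_base)
  \<comment> \<open>Since the line through \<open>v\<close> is a nonzero summand, the complement
    vanishes: \<open>C\<close> and the spaces at all other vertices are zero.\<close>
  ultimately have "\<not> nonzero (M\<lparr>space := ?S'\<rparr>)"
    using assms(1) unfolding indecomposable_def by blast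
  hence "total_dim (M\<lparr>space := ?S'\<rparr>) = 0"
    using total_dim_eq_0[OF submodule_is_module[OF N']] by simp
  moreover have "fvec.dim (space M x) = Suc (fvec.dim C)"
    unfolding C(5) using dim_insert_span[OF fin_dim_subspace_subset[OF is_module_fin_dim[OF M] C(1,3)] C(4)] .
  ultimately show ?thesis by (cases x) (simp_all add: total_dim_def)
qed

text \<open>The image of the indecomposable projective module at the given vertex under the
  homomorphism that sends the trivial path to \<open>w\<close>.\<close>

fun gen_space :: "'k::field rep \<Rightarrow> vertex \<Rightarrow> (nat \<Rightarrow> 'k) \<Rightarrow> vertex \<Rightarrow> (nat \<Rightarrow> 'k) set" where
  "gen_space M V1 w V1 = fvec.span {w}"
| "gen_space M V1 w V2 = fvec.span {act M Alpha w}"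
| "gen_space M V1 w V3 = fvec.span {act M Beta (act M Alpha w), act M Gamma (act M Alpha w)}"
| "gen_space M V2 w V1 = {0}"
| "gen_space M V2 w V2 = fvec.span {w}"
| "gen_space M V2 w V3 = fvec.span {act M Beta w, act M Gamma w}"
| "gen_space M V3 w V1 = {0}"
| "gen_space M V3 w V2 = {0}"
| "gen_space M V3 w V3 = fvec.span {w}"

definition gen :: "'k::field rep \<Rightarrow> vertex \<Rightarrow> (nat \<Rightarrow> 'k) \<Rightarrow> 'k rep" where
  "gen M x w = M\<lparr>space := gen_space M x w\<rparr>"

lemma space_gen [simp]: "space (gen M x w) = gen_space M x w"
  by (simp add: gen_def)

lemma act_gen [simp]: "act (gen M x w) = act M"
  by (simp add: gen_def)

lemma gen_space_cong: "act N = act M \<Longrightarrow> gen_space N x w y = gen_space M x w y"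
  by (cases x; cases y) (simp_all only: gen_space.simps)

lemma gen_cong: "act N = act M \<Longrightarrow> gen N x w = gen M x w"
proof (rule rep.equality)
  assume *: "act N = act M"
  show "space (gen N x w) = space (gen M x w)"
    unfolding space_gen by (rule ext) (rule gen_space_cong[OF *])
  show "act (gen N x w) = act (gen M x w)" unfolding act_gen by (rule *)
qed simp

lemma gen_space_self: "w \<in> gen_space M x w x"
  by (cases x) (simp_all add: fvec.span_base)

lemma gen_space_minimal:
  assumes "is_module N" "w \<in> space N x" "act N = act M"
  shows "gen_space M x w y \<subseteq> space N y"
proof -
  have closed: "v \<in> space N (src a) \<Longrightarrow> act M a v \<in> space N (tgt a)" for a v
    using act_closed[OF assms(1)] assms(3) by metis
  have c: "v \<in> space N V1 \<Longrightarrow> act M Alpha v \<in> space N V2"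
    "v \<in> space N V2 \<Longrightarrow> act M Beta v \<in> space N V3"
    "v \<in> space N V2 \<Longrightarrow> act M Gamma v \<in> space N V3" for v
    using closed[of v Alpha] closed[of v Beta] closed[of v Gamma] by simp_all
  show ?thesis
    using assms(2) c[of w] c(2,3)[of "act M Alpha w"] is_module_zero[OF assms(1), of y]
      is_module_subspace[OF assms(1), of y]
    by (cases x; cases y) (simp_all add: fvec.span_minimal del: fvec.span_insert_0)
qed

lemma act_extend:
  assumes "is_module M"
  shows "\<exists>g. Vector_Spaces.linear fscale fscale g \<and> (\<forall>u\<in>space M (src a). g u = act M a u)"
  by (rule linear_map_extend[OF is_module_subspace[OF assms] is_module_linear[OF assms]])

lemma act_span:
  assumes "is_module M" "B \<subseteq> space M (src a)" "v \<in> fvec.span B"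
  shows "act M a v \<in> fvec.span (act M a ` B)"
proof -
  obtain g where g: "Vector_Spaces.linear fscale fscale g" "\<forall>u\<in>space M (src a). g u = act M a u"
    using act_extend[OF assms(1)] by metis
  interpret g: Vector_Spaces.linear fscale fscale g by (rule g(1))
  have "fvec.span B \<subseteq> space M (src a)"
    using assms(1,2) by (simp add: fvec.span_minimal is_module_subspace)
  hence "act M a v = g v" using g(2) assms(3) by auto
  also have "\<dots> \<in> fvec.span (g ` B)" using assms(3) by (simp add: g.span_image)
  also have "g ` B = act M a ` B" using g(2) assms(2) by (intro image_cong) auto
  finally show ?thesis .
qed

lemma gen_submodule:
  assumes M: "is_module M" and w: "w \<in> space M x"
  shows "submodule (gen M x w) M"
  unfolding gen_def
proof (rule submodule_restrict[OF M])
  show subsp: "fvec.subspace (gen_space M x w y)" for y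
    by (cases x; cases y) simp_all
  show "gen_space M x w y \<subseteq> space M y" for y
    by (rule gen_space_minimal[OF M w refl])
  show "act M a v \<in> gen_space M x w (tgt a)" if v: "v \<in> gen_space M x w (src a)" for a v
  proof -
    have zero: "v = 0 \<Longrightarrow> ?thesis"
      using act_zero[OF M] by (cases x; cases a) (simp_all add: fvec.span_zero)
    show ?thesis
    proof (cases "src a = x")
      case True
      hence "v \<in> fvec.span {w}" using v by (cases x) auto
      hence "act M a v \<in> fvec.span {act M a w}"
        using act_span[OF M, of "{w}" a v] w True by simp
      moreover have "act M a w \<in> gen_space M x w (tgt a)"
        using True by (cases a) (auto simp: fvec.span_base)
      ultimately show ?thesis
        using fvec.span_minimal[of "{act M a w}" "gen_space M x w (tgt a)"]
        by (cases x; cases "tgt a") (auto simp: fvec.subspace_single_0)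
    next
      case False
      show ?thesis
      proof (cases "x = V1 \<and> src a = V2")
        case True
        have "act M Alpha w \<in> space M V2" using act_closed[OF M, of w Alpha] w True by simp
        moreover have "v \<in> fvec.span {act M Alpha w}" using v True by simp
        ultimately have "act M a v \<in> fvec.span {act M a (act M Alpha w)}"
          using act_span[OF M, of "{act M Alpha w}" a v] True by simp
        moreover have "fvec.span {act M a (act M Alpha w)} \<subseteq> gen_space M x w (tgt a)"
          using True by (cases a) (simp_all add: fvec.span_mono)
        ultimately show ?thesis by blast
      next
        case F: False
        hence "v = 0" using False v by (cases x; cases a) auto
        thus ?thesis by (rule zero)
      qed
    qed
  qed
qed

text \<open>At vertex \<open>x\<close> the generated module is the line through \<open>w\<close>. If
  \<open>w = u + v\<close> along the decomposition, then \<open>u\<close> is a multiple of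
  \<open>w\<close>, so \<open>w\<close> itself lies in one summand, and that summand is
  everything.\<close>

lemma gen_nonzero_subset:
  assumes "is_module M" "w \<in> space M x" "direct_sum_of (gen M x w) N N'"
  shows "\<not> nonzero N \<or> \<not> nonzero N'"
proof -
  have full: "\<not> nonzero K'"
    if K: "direct_sum_of (gen M x w) K K'" "w \<in> space K x" for K K'
  proof -
    have sub: "submodule K (gen M x w)" "submodule K' (gen M x w)"
      using K(1) unfolding direct_sum_of_def by blast+
    have "gen_space M x w y \<subseteq> space K y" for y
      using gen_space_minimal[OF submodule_is_module[OF sub(1)] K(2)] submodule_act[OF sub(1)] by simp
    hence "space K' y \<subseteq> space K y" for y using submodule_subset[OF sub(2), of y] by auto
    hence "space K' y = {0}" for y using K(1) unfolding direct_sum_of_def by blast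
    thus ?thesis unfolding nonzero_def by blast
  qed
  have swap: "direct_sum_of (gen M x w) N' N"
    using assms(3) unfolding direct_sum_of_def by (auto simp: Int_commute) (metis add.commute)+
  have sub: "submodule N (gen M x w)" "submodule N' (gen M x w)"
    using assms(3) unfolding direct_sum_of_def by blast+
  have "gen_space M x w x = {u + v |u v. u \<in> space N x \<and> v \<in> space N' x}"
    using assms(3) unfolding direct_sum_of_def by simp
  then obtain u v where uv: "u \<in> space N x" "v \<in> space N' x" "w = u + v"
    using gen_space_self[of w M x] by blast
  have "u \<in> fvec.span {w}" using uv(1) submodule_subset[OF sub(1), of x] by (cases x) auto
  then obtain k where k: "u = fscale k w" by (auto simp: fvec.span_singleton)
  show ?thesis
  proof (cases "k = 0")
    case True
    hence "w = v" using uv(3) k by (simp only: fvec.scale_zero_left add_0_left)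
    thus ?thesis using full[OF swap] uv(2) by simp
  next
    case False
    have "w = fscale (inverse k) u" unfolding k using False by (simp add: fvec.scale_scale)
    hence "w \<in> space N x"
      using uv(1) is_module_subspace[OF submodule_is_module[OF sub(1)]] by (metis fvec.subspace_scale)
    thus ?thesis using full[OF assms(3)] by simp
  qed
qed

lemma gen_indecomposable:
  assumes "is_module M" "w \<in> space M x" "w \<noteq> 0"
  shows "indecomposable (gen M x w)"
proof -
  have "is_module (gen M x w)" using gen_submodule[OF assms(1,2)] by (rule submodule_is_module)
  moreover from this have "nonzero (gen M x w)"
    using gen_space_self[of w M x] assms(3) by (auto simp: nonzero_iff)
  ultimately show ?thesis
    using gen_nonzero_subset[OF assms(1,2)] unfolding indecomposable_def by blast
qed

section \<open>Short chains of modules generated by one element\<close>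

lemma dim_zero: "fvec.dim {0 :: nat \<Rightarrow> 'k::field} = 0"
  using fvec.dim_span_eq_card_independent[of "{} :: (nat \<Rightarrow> 'k) set"] fvec.independent_empty by simp

lemma dim_single: "v \<noteq> 0 \<Longrightarrow> fvec.dim {v} = 1"
  by (subst fvec.dim_eq_card_independent) auto

text \<open>Independence is expressed by coefficients because the set \<open>{a, b}\<close> would
  also be independent if \<open>a\<close> and \<open>b\<close> were the same nonzero vector.\<close>

lemma dim_pair_independent:
  assumes "\<And>x y. fscale x a + fscale y b = 0 \<Longrightarrow> x = 0 \<and> y = 0"
  shows "fvec.dim {a, b} = 2"
proof -
  have "fscale 1 a + fscale 0 b = a" by (simp only: fvec.scale_one fvec.scale_zero_left add_0_right)
  hence "a \<noteq> 0" using assms[of 1 0] by auto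
  have "b \<notin> fvec.span {a}"
  proof
    assume "b \<in> fvec.span {a}"
    then obtain k where "b = fscale k a" by (auto simp: fvec.span_singleton)
    hence "fscale k a + fscale (- 1) b = 0"
      by (simp only: fvec.scale_minus_left fvec.scale_one right_minus)
    thus False using assms[of k "- 1"] by simp
  qed
  hence "fvec.dim (fvec.span (insert b (fvec.span {a}))) = 2"
    using dim_insert_span[of "fvec.span {a}" b] dim_single[OF \<open>a \<noteq> 0\<close>]
    unfolding fvec.dim_span by (simp add: fin_dim_subspace_span)
  thus ?thesis unfolding span_insert_span fvec.dim_span by (simp add: insert_commute)
qed

lemma span_pair_dependent:
  assumes "fscale x a + fscale y b = 0" "x \<noteq> 0"
  shows "fvec.span {a, b} = fvec.span {b}"
proof -
  have "fscale (inverse x) (fscale x a + fscale y b) = a + fscale (inverse x * y) b"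
    using assms(2) by (simp add: fvec.scale_right_distrib fvec.scale_scale)
  hence "a = - fscale (inverse x * y) b"
    unfolding assms(1) fvec.scale_zero_right by (metis eq_neg_iff_add_eq_0)
  hence "a \<in> fvec.span {b}" by (simp add: fvec.span_base fvec.span_scale fvec.span_neg)
  thus ?thesis by (simp add: fvec.span_redundant)
qed

text \<open>A generated module depends only on the action and on its generator, so \<open>u\<close>
  lying in the module generated by \<open>w\<close> gives an inclusion; different total dimensions
  make it proper.\<close>

lemma chain_length_sets_gen_step:
  assumes M: "is_module M" and J: "J \<in> chain_length_sets (gen M y u)"
    and w: "w \<in> space M x" "w \<noteq> 0" and u: "u \<in> gen_space M x w y"
    and less: "total_dim (gen M y u) \<noteq> total_dim (gen M x w)"
  shows "insert (total_dim (gen M x w)) J \<in> chain_length_sets (gen M x w)"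
proof (rule chain_length_sets_insert[OF J])
  have "is_module (gen M x w)" using gen_submodule[OF M w(1)] by (rule submodule_is_module)
  hence "submodule (gen (gen M x w) y u) (gen M x w)" using u by (intro gen_submodule) simp_all
  thus "submodule (gen M y u) (gen M x w)" by (simp add: gen_cong[of "gen M x w" M])
  show "indecomposable (gen M x w)" using gen_indecomposable[OF M w] .
  show "gen M y u \<noteq> gen M x w" using less by auto
qed

text \<open>Every nonzero member of the pencil spanned by \<open>Beta\<close> and
  \<open>Gamma\<close> is injective at vertex 2. Two coefficients are used instead of one eigenvalue
  so that the eigenvalue infinity is excluded as well. The condition is inherited by
  submodules.\<close>

definition eigenvector_free :: "'k::field rep \<Rightarrow> bool" where
  "eigenvector_free M \<longleftrightarrow> (\<forall>v\<in>space M V2. \<forall>x y. v \<noteq> 0 \<longrightarrow>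
     fscale x (act M Beta v) + fscale y (act M Gamma v) = 0 \<longrightarrow> x = 0 \<and> y = 0)"

lemma total_dim_gen_V3: "u \<noteq> 0 \<Longrightarrow> total_dim (gen M V3 u) = 1"
  by (simp add: total_dim_def dim_zero dim_single)

lemma total_dim_gen_V2:
  "v \<noteq> 0 \<Longrightarrow> total_dim (gen M V2 v) = 1 + fvec.dim {act M Beta v, act M Gamma v}"
  by (simp add: total_dim_def dim_zero dim_single)

text \<open>The two images of \<open>v\<close> are dependent but not both zero, so they span a line.
  Thus \<open>v\<close> generates a module of dimension vector (0, 1, 1), and that line is its
  submodule of length 1.\<close>

lemma chain_one_two:
  assumes M: "is_module M" and v: "v \<in> space M V2" "v \<noteq> 0"
    and dep: "fscale x (act M Beta v) + fscale y (act M Gamma v) = 0" "x \<noteq> 0 \<or> y \<noteq> 0"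
    and nz: "act M Beta v \<noteq> 0 \<or> act M Gamma v \<noteq> 0"
  shows "{1, 2} \<in> chain_length_sets M"
proof -
  obtain u where u: "fvec.span {act M Beta v, act M Gamma v} = fvec.span {u}"
    "u = act M Beta v \<or> u = act M Gamma v"
  proof (cases "x = 0")
    case True
    hence "fscale y (act M Gamma v) + fscale x (act M Beta v) = 0"
      using dep(1) by (simp only: add.commute)
    hence "fvec.span {act M Gamma v, act M Beta v} = fvec.span {act M Beta v}"
      using dep(2) True by (intro span_pair_dependent) auto
    thus ?thesis using that by (simp add: insert_commute)
  next
    case False
    thus ?thesis using that span_pair_dependent[OF dep(1)] by blast
  qed
  have "u \<noteq> 0"
  proof
    assume "u = 0"
    hence "fvec.span {act M Beta v, act M Gamma v} = {0}" using u(1) fvec.span_insert_0[of "{}"] by simp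
    thus False using nz fvec.span_base[of _ "{act M Beta v, act M Gamma v}"] by auto
  qed
  have u3: "u \<in> space M V3"
    using u(2) act_closed[OF M, of v Beta] act_closed[OF M, of v Gamma] v(1) by auto
  have d: "total_dim (gen M V3 u) = 1" "total_dim (gen M V2 v) = 2"
    using total_dim_gen_V3[OF \<open>u \<noteq> 0\<close>] total_dim_gen_V2[OF v(2)] fvec.span_eq_dim[OF u(1)] dim_single[OF \<open>u \<noteq> 0\<close>] by simp_all
  have "{1} \<in> chain_length_sets (gen M V3 u)"
    using chain_length_sets_singleton[OF gen_indecomposable[OF M u3 \<open>u \<noteq> 0\<close>]] d(1) by metis
  hence "insert 2 {1} \<in> chain_length_sets (gen M V2 v)"
    using chain_length_sets_gen_step[OF M _ v, of "{1}" V3 u] d u(1) by (simp add: fvec.span_base)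
  thus ?thesis using chain_length_sets_mono[OF gen_submodule[OF M v(1)]] by (simp add: insert_commute)
qed

text \<open>Here \<open>w\<close> generates a module of dimension vector (1, 1, 0), in which
  \<open>v\<close> generates a simple submodule.\<close>

lemma chain_one_two_V1:
  assumes M: "is_module M" and w: "w \<in> space M V1" and v: "v = act M Alpha w" "v \<noteq> 0"
    and "act M Beta v = 0" "act M Gamma v = 0"
  shows "{1, 2} \<in> chain_length_sets M"
proof -
  have v2: "v \<in> space M V2" using act_closed[OF M, of w Alpha] w v by simp
  have "w \<noteq> 0" using v act_zero[OF M] by auto
  have d: "total_dim (gen M V2 v) = 1" "total_dim (gen M V1 w) = 2"
    using total_dim_gen_V2[OF v(2)] assms(5,6) v dim_zero dim_single[OF v(2)] dim_single[OF \<open>w \<noteq> 0\<close>]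
    by (simp_all add: total_dim_def)
  have "{1} \<in> chain_length_sets (gen M V2 v)"
    using chain_length_sets_singleton[OF gen_indecomposable[OF M v2 v(2)]] d(1) by metis
  hence "insert 2 {1} \<in> chain_length_sets (gen M V1 w)"
    using chain_length_sets_gen_step[OF M _ w \<open>w \<noteq> 0\<close>, of "{1}" V2 v] d v(1) by (simp add: fvec.span_base)
  thus ?thesis using chain_length_sets_mono[OF gen_submodule[OF M w]] by (simp add: insert_commute)
qed

text \<open>The chain is generated by \<open>u\<close>, \<open>v\<close> and \<open>w\<close> in
  turn, with dimension vectors (0, 0, 1), (0, 1, 2) and (1, 1, 2). Absence of eigenvectors makes the
  two images of \<open>v\<close> independent.\<close>

lemma chain_one_three_four:
  assumes M: "is_module M" "eigenvector_free M" and w: "w \<in> space M V1" "act M Alpha w \<noteq> 0"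
  shows "{1, 3, 4} \<in> chain_length_sets M"
proof -
  define v where "v = act M Alpha w"
  have v: "v \<in> space M V2" "v \<noteq> 0" using act_closed[OF M(1), of w Alpha] w by (simp_all add: v_def)
  define u where "u = act M Beta v"
  have "w \<noteq> 0" using w act_zero[OF M(1)] by auto
  have ind: "x = 0 \<and> y = 0" if "fscale x (act M Beta v) + fscale y (act M Gamma v) = 0" for x y
    using M(2) v that unfolding eigenvector_free_def by blast
  have u: "u \<in> space M V3" using act_closed[OF M(1), of v Beta] v by (simp add: u_def)
  have "u \<noteq> 0"
  proof
    assume "u = 0"
    hence "fscale 1 (act M Beta v) + fscale 0 (act M Gamma v) = 0"
      unfolding u_def by (simp only: fvec.scale_zero_left fvec.scale_zero_right add_0_right)
    thus False using ind[of 1 0] by simp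
  qed
  have d2: "fvec.dim {act M Beta v, act M Gamma v} = 2"
    using ind by (rule dim_pair_independent)
  have d: "total_dim (gen M V3 u) = 1" "total_dim (gen M V2 v) = 3" "total_dim (gen M V1 w) = 4"
    using total_dim_gen_V3[OF \<open>u \<noteq> 0\<close>] total_dim_gen_V2[OF v(2)] d2
      dim_single[OF \<open>w \<noteq> 0\<close>] dim_single[OF v(2)]
    by (simp_all add: total_dim_def v_def)
  have "{1} \<in> chain_length_sets (gen M V3 u)"
    using chain_length_sets_singleton[OF gen_indecomposable[OF M(1) u \<open>u \<noteq> 0\<close>]] d(1) by metis
  hence "insert 3 {1} \<in> chain_length_sets (gen M V2 v)"
    using chain_length_sets_gen_step[OF M(1) _ v, of "{1}" V3 u] d by (simp add: fvec.span_base u_def)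
  hence "insert 4 (insert 3 {1}) \<in> chain_length_sets (gen M V1 w)"
    using chain_length_sets_gen_step[OF M(1) _ w(1) \<open>w \<noteq> 0\<close>, of "insert 3 {1}" V2 v] d
    by (simp add: fvec.span_base v_def)
  moreover have "insert 4 (insert 3 {1}) = {1, 3, 4 :: nat}" by blast
  ultimately show ?thesis using chain_length_sets_mono[OF gen_submodule[OF M(1) w(1)]] by metis
qed

text \<open>Whenever a vector yields none of the short chains, all outgoing arrows kill it and it
  lies outside the images of the incoming ones. Then its line splits off by
  \<open>split_simple\<close> and the module is simple. At vertex 2 the complement is chosen to
  contain the image of \<open>Alpha\<close>.\<close>

lemma indecomposable_cases:
  assumes ind: "indecomposable M"
  obtains "total_dim M = 1"
  | "{1, 2} \<in> chain_length_sets M"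
  | "{1, 3, 4} \<in> chain_length_sets M"
  | "space M V1 = {0}" "eigenvector_free M"
proof -
  have M: "is_module M" using ind by (rule indecomposable_is_module)
  show ?thesis
  proof (cases "eigenvector_free M")
    case False
    then obtain v x y where v: "v \<in> space M V2" "v \<noteq> 0"
      and dep: "fscale x (act M Beta v) + fscale y (act M Gamma v) = 0" "x \<noteq> 0 \<or> y \<noteq> 0"
      unfolding eigenvector_free_def by blast
    show ?thesis
    proof (cases "act M Beta v = 0 \<and> act M Gamma v = 0")
      case False
      thus ?thesis using that(2) chain_one_two[OF M v dep] by blast
    next
      case z: True
      show ?thesis
      proof (cases "v \<in> act M Alpha ` space M V1")
        case True
        thus ?thesis using that(2) chain_one_two_V1[OF M] z v(2) by blast
      next
        case False
        obtain g where g: "Vector_Spaces.linear fscale fscale g" "\<forall>u\<in>space M V1. g u = act M Alpha u"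
          using act_extend[OF M, of Alpha] by (metis src.simps(1))
        interpret g: Vector_Spaces.linear fscale fscale g by (rule g(1))
        have img: "act M Alpha ` space M V1 = g ` space M V1" using g(2) by force
        have "total_dim M = 1"
        proof (rule split_simple[OF ind v(1)])
          show "fvec.subspace (act M Alpha ` space M V1)"
            unfolding img by (rule g.subspace_image[OF is_module_subspace[OF M]])
          show "act M Alpha ` space M V1 \<subseteq> space M V2"
            using act_closed[OF M, of _ Alpha] by auto
          show "v \<notin> act M Alpha ` space M V1" by (rule False)
          show "act M a v = 0" if "src a = V2" for a using that z by (cases a) auto
          show "act M a u \<in> act M Alpha ` space M V1" if "tgt a = V2" "u \<in> space M (src a)" for a u
            using that by (cases a) auto
        qed
        thus ?thesis by (rule that(1))
      qed
    qed
  next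
    case True
    show ?thesis
    proof (cases "space M V1 = {0}")
      case True
      thus ?thesis using that(4) \<open>eigenvector_free M\<close> by blast
    next
      case False
      then obtain w where w: "w \<in> space M V1" "w \<noteq> 0" using is_module_zero[OF M, of V1] by auto
      show ?thesis
      proof (cases "act M Alpha w = 0")
        case False
        thus ?thesis using that(3) chain_one_three_four[OF M True w(1)] by blast
      next
        case z: True
        have "total_dim M = 1"
        proof (rule split_simple[OF ind w(1), where D = "{0}"])
          show "act M a w = 0" if "src a = V1" for a using that z by (cases a) auto
          show "act M a u \<in> {0}" if "tgt a = V1" "u \<in> space M (src a)" for a u
            using that by (cases a) auto
        qed (use w is_module_zero[OF M, of V1] in auto)
        thus ?thesis by (rule that(1))
      qed
    qed
  qed
qed

section \<open>Modules without eigenvectors\<close>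

text \<open>
  For modules without eigenvectors that vanish at vertex 1, the reflection functor can be realised
  inside the module: after identifying \<open>space M V2\<close> with its image under \<open>Beta\<close>, the kernel of
  the map from two copies of \<open>space M V2\<close> to \<open>space M V3\<close> consists of the \<open>v\<close> that \<open>Gamma\<close>
  sends into that image.
\<close>

definition kron_sub_space :: "'k::field rep \<Rightarrow> vertex \<Rightarrow> (nat \<Rightarrow> 'k) set" where
  "kron_sub_space M x = (case x of
     V1 \<Rightarrow> {0}
   | V2 \<Rightarrow> {v \<in> space M V2. act M Gamma v \<in> act M Beta ` space M V2}
   | V3 \<Rightarrow> act M Beta ` space M V2)"

definition kron_sub :: "'k::field rep \<Rightarrow> 'k rep" where
  "kron_sub M = M\<lparr>space := kron_sub_space M\<rparr>"

lemma space_kron_sub: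
  "space (kron_sub M) V1 = {0}"
  "space (kron_sub M) V2 = {v \<in> space M V2. act M Gamma v \<in> act M Beta ` space M V2}"
  "space (kron_sub M) V3 = act M Beta ` space M V2"
  by (simp_all add: kron_sub_def kron_sub_space_def)

lemma act_kron_sub: "act (kron_sub M) = act M"
  by (simp add: kron_sub_def)

section \<open>The submodule \<open>kron_sub M\<close>: indecomposability and dimensions\<close>

context
  fixes M :: "'k::field rep" and b c :: "(nat \<Rightarrow> 'k) \<Rightarrow> (nat \<Rightarrow> 'k)"
  assumes ind: "indecomposable M" and V1: "space M V1 = {0}" and free: "eigenvector_free M"
    and V2: "space M V2 \<noteq> {0}"
    and linb: "Vector_Spaces.linear fscale fscale b"
    and linc: "Vector_Spaces.linear fscale fscale c"
    and eqb: "\<forall>v\<in>space M V2. act M Beta v = b v"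
    and eqc: "\<forall>v\<in>space M V2. act M Gamma v = c v"
begin

interpretation b: Vector_Spaces.linear fscale fscale b by (rule linb)
interpretation c: Vector_Spaces.linear fscale fscale c by (rule linc)

lemma actb: "v \<in> space M V2 \<Longrightarrow> act M Beta v = b v"
  using eqb by blast

lemma actc: "v \<in> space M V2 \<Longrightarrow> act M Gamma v = c v"
  using eqc by blast

lemma kron_module: "is_module M"
  using ind by (rule indecomposable_is_module)

lemma kron_subspace: "fvec.subspace (space M x)"
  using kron_module by (rule is_module_subspace)

lemma kron_free:
  "v \<in> space M V2 \<Longrightarrow> fscale x (b v) + fscale y (c v) = 0 \<Longrightarrow> v = 0 \<or> x = 0 \<and> y = 0"
  using free actb actc unfolding eigenvector_free_def by metis

lemma kron_closed: "v \<in> space M V2 \<Longrightarrow> b v \<in> space M V3" "v \<in> space M V2 \<Longrightarrow> c v \<in> space M V3"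
  using act_closed[OF kron_module, of v Beta] act_closed[OF kron_module, of v Gamma]
  by (simp_all add: actb actc)

lemma kron_b_eq_0: "v \<in> space M V2 \<Longrightarrow> b v = 0 \<Longrightarrow> v = 0"
  using kron_free[of v 1 0] by (simp add: fvec.scale_zero_left)

lemma kron_inj: "inj_on b (space M V2)"
proof (rule inj_onI)
  fix u v assume "u \<in> space M V2" "v \<in> space M V2" "b u = b v"
  hence "u - v \<in> space M V2" "b (u - v) = 0"
    by (simp_all add: fvec.subspace_diff[OF kron_subspace] b.diff)
  hence "u - v = 0" by (rule kron_b_eq_0)
  thus "u = v" by (metis eq_iff_diff_eq_0)
qed

lemma space_kron_sub':
  "space (kron_sub M) V2 = {v \<in> space M V2. c v \<in> b ` space M V2}"
  "space (kron_sub M) V3 = b ` space M V2"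
proof -
  have "act M Beta ` space M V2 = b ` space M V2" by (rule image_cong[OF refl actb])
  thus "space (kron_sub M) V2 = {v \<in> space M V2. c v \<in> b ` space M V2}"
    "space (kron_sub M) V3 = b ` space M V2"
    using actc by (auto simp: space_kron_sub)
qed

lemma kron_sub_submodule: "submodule (kron_sub M) M"
  unfolding kron_sub_def
proof (rule submodule_restrict[OF kron_module])
  have sp: "kron_sub_space M x = space (kron_sub M) x" for x by (simp add: kron_sub_def)
  have "{v \<in> space M V2. c v \<in> b ` space M V2} = space M V2 \<inter> {v. c v \<in> b ` space M V2}" by blast
  hence "fvec.subspace {v \<in> space M V2. c v \<in> b ` space M V2}"
    using fvec.subspace_inter[OF kron_subspace c.subspace_linear_preimage[OF b.subspace_image[OF kron_subspace]]]
    by simp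
  thus "fvec.subspace (kron_sub_space M x)" for x
    unfolding sp by (cases x) (simp_all add: space_kron_sub(1) space_kron_sub' b.subspace_image kron_subspace)
  show "kron_sub_space M x \<subseteq> space M x" for x
    unfolding sp using V1 kron_closed by (cases x) (auto simp: space_kron_sub(1) space_kron_sub')
  have z: "\<exists>x\<in>space M V2. b x = 0" using fvec.subspace_0[OF kron_subspace] b.zero by blast
  show "act M a v \<in> kron_sub_space M (tgt a)" if "v \<in> kron_sub_space M (src a)" for a v
    using that act_zero[OF kron_module] fvec.subspace_0[OF kron_subspace, of V2] c.zero z
    unfolding sp
    by (cases a) (auto simp: space_kron_sub(1) space_kron_sub' actb actc image_iff)
qed

text \<open>A vector at vertex 3 outside the images of both arrows would split off as a simple
  summand and force total dimension 1, but the spaces at vertices 2 and 3 would then both be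
  nonzero.\<close>

lemma kron_V3: "space M V3 = {b x + c y | x y. x \<in> space M V2 \<and> y \<in> space M V2}"
proof (rule ccontr)
  let ?D = "{b x + c y | x y. x \<in> space M V2 \<and> y \<in> space M V2}"
  assume neq: "space M V3 \<noteq> ?D"
  have D: "?D = {u + w | u w. u \<in> b ` space M V2 \<and> w \<in> c ` space M V2}" by blast
  have subD: "fvec.subspace ?D" unfolding D
    by (rule fvec.subspace_sums[OF b.subspace_image[OF kron_subspace] c.subspace_image[OF kron_subspace]])
  have D_sub: "?D \<subseteq> space M V3"
    using kron_closed fvec.subspace_add[OF kron_subspace] by blast
  then obtain v where v: "v \<in> space M V3" "v \<notin> ?D" using neq by blast
  have zero: "0 \<in> space M V2" using is_module_zero[OF kron_module] .
  have inD: "b u \<in> ?D" "c u \<in> ?D" if "u \<in> space M V2" for u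
  proof -
    have "b u = b u + c 0" "c u = b 0 + c u" by (simp_all only: b.zero c.zero add_0_left add_0_right)
    thus "b u \<in> ?D" "c u \<in> ?D" using that zero by blast+
  qed
  have "total_dim M = 1"
  proof (rule split_simple[OF ind v(1) _ subD D_sub v(2)])
    show "act M a v = 0" if "src a = V3" for a using that by (cases a) auto
    show "act M a u \<in> ?D" if "tgt a = V3" "u \<in> space M (src a)" for a u
      using that inD actb actc by (cases a) auto
  qed
  moreover have "fvec.dim (space M V2) \<noteq> 0"
    using V2 dim_eq_0_subspace[OF is_module_fin_dim[OF kron_module]] by blast
  moreover have "fvec.dim (space M V3) \<noteq> 0"
  proof
    assume "fvec.dim (space M V3) = 0"
    hence "v = 0" using v(1) dim_eq_0_subspace[OF is_module_fin_dim[OF kron_module, of V3]] by auto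
    thus False using v(2) fvec.subspace_0[OF subD] by metis
  qed
  ultimately show False by (simp add: total_dim_def)
qed

text \<open>
  A decomposition of \<^term>\<open>kron_sub M\<close> is induced by one of \<^term>\<open>M\<close>: pull it back to vertex 2
  along the injective map \<open>Beta\<close>, and generate.
\<close>

definition kron_lift :: "'k rep \<Rightarrow> vertex \<Rightarrow> (nat \<Rightarrow> 'k) set" where
  "kron_lift N x = (case x of
     V1 \<Rightarrow> {0}
   | V2 \<Rightarrow> {v \<in> space M V2. b v \<in> space N V3}
   | V3 \<Rightarrow> {b u + c w | u w. u \<in> space M V2 \<and> b u \<in> space N V3 \<and> w \<in> space M V2 \<and> b w \<in> space N V3})"

lemma kron_lift_submodule:
  assumes "submodule N (kron_sub M)"
  shows "submodule (M\<lparr>space := kron_lift N\<rparr>) M"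
proof (rule submodule_restrict[OF kron_module])
  let ?A = "{v \<in> space M V2. b v \<in> space N V3}"
  have N: "is_module N" using assms by (rule submodule_is_module)
  have "?A = space M V2 \<inter> {v. b v \<in> space N V3}" by blast
  hence A: "fvec.subspace ?A"
    using fvec.subspace_inter[OF kron_subspace b.subspace_linear_preimage[OF is_module_subspace[OF N]]] by simp
  have "kron_lift N V3 = {u + w | u w. u \<in> b ` ?A \<and> w \<in> c ` ?A}"
    unfolding kron_lift_def by auto
  hence "fvec.subspace (kron_lift N V3)"
    using fvec.subspace_sums[OF b.subspace_image[OF A] c.subspace_image[OF A]] by simp
  thus "fvec.subspace (kron_lift N x)" for x using A by (cases x) (simp_all add: kron_lift_def)
  show "kron_lift N x \<subseteq> space M x" for x
    using V1 kron_closed fvec.subspace_add[OF kron_subspace]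
    by (cases x) (auto simp: kron_lift_def)
  show "act M a v \<in> kron_lift N (tgt a)" if v: "v \<in> kron_lift N (src a)" for a v
  proof (cases "src a = V1")
    case True
    hence "v = 0" "tgt a = V2" using v by (cases a; simp add: kron_lift_def)+
    thus ?thesis using act_zero[OF kron_module] fvec.subspace_0[OF A] by (simp add: kron_lift_def)
  next
    case False
    hence a: "src a = V2" "tgt a = V3" "a = Beta \<or> a = Gamma" by (cases a; simp)+
    have vA: "v \<in> ?A" using v a(1) by (simp add: kron_lift_def)
    have mem: "b x + c y \<in> kron_lift N V3" if "x \<in> ?A" "y \<in> ?A" for x y
      using that unfolding kron_lift_def by auto
    have "0 \<in> ?A" by (rule fvec.subspace_0[OF A])
    hence "b v \<in> kron_lift N V3" "c v \<in> kron_lift N V3"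
      using mem[of v 0] mem[of 0 v] vA by (simp_all add: b.zero c.zero)
    moreover have "act M a v = b v \<or> act M a v = c v"
      using a(3) vA actb actc by auto
    ultimately show ?thesis using a(2) by auto
  qed
qed

text \<open>The lifts add up to \<open>M\<close> because every vector at vertex 3 has the form
  \<open>b y + c z\<close>, and the injective \<open>b\<close> carries the splitting of its image
  back to vertex 2. The delicate point is that the lifts meet only in zero at vertex 3; there the
  splitting at vertex 2 of \<open>kron_sub M\<close> is used.\<close>

lemma kron_sub_no_decomposition:
  assumes ds: "direct_sum_of (kron_sub M) N N'" and nz: "nonzero N" "nonzero N'"
  shows False
proof -
  have sub: "submodule N (kron_sub M)" "submodule N' (kron_sub M)"
    using ds by (simp_all add: direct_sum_of_def)
  have NM: "is_module N" "is_module N'" using sub by (simp_all add: submodule_is_module)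
  have act_N: "act N = act M" "act N' = act M"
    using submodule_act[OF sub(1)] submodule_act[OF sub(2)] by (simp_all add: act_kron_sub)
  have sum3: "b ` space M V2 = {u + v |u v. u \<in> space N V3 \<and> v \<in> space N' V3}"
    and int3: "space N V3 \<inter> space N' V3 = {0}"
    and sum2: "{v \<in> space M V2. c v \<in> b ` space M V2} = {u + v |u v. u \<in> space N V2 \<and> v \<in> space N' V2}"
    using ds unfolding direct_sum_of_def by (metis space_kron_sub')+
  have N3: "space K V3 \<subseteq> b ` space M V2" if "submodule K (kron_sub M)" for K
    using submodule_subset[OF that, of V3] by (simp add: space_kron_sub')
  have N2: "w \<in> space M V2 \<and> b w \<in> space K V3 \<and> c w \<in> space K V3"
    if K: "submodule K (kron_sub M)" and w: "w \<in> space K V2" for K w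
  proof -
    have "w \<in> space M V2" using submodule_subset[OF K, of V2] w by (auto simp: space_kron_sub')
    moreover have "act K = act M" using submodule_act[OF K] by (simp add: act_kron_sub)
    ultimately show ?thesis
      using act_closed[OF submodule_is_module[OF K], of w Beta] act_closed[OF submodule_is_module[OF K], of w Gamma] w
      by (simp add: actb actc)
  qed
  have split2: "\<exists>u w. v = u + w \<and> u \<in> space M V2 \<and> b u \<in> space N V3 \<and> w \<in> space M V2 \<and> b w \<in> space N' V3"
    if v: "v \<in> space M V2" for v
  proof -
    have "b v \<in> b ` space M V2" using v by (rule imageI)
    then obtain p q where pq: "b v = p + q" "p \<in> space N V3" "q \<in> space N' V3"
      unfolding sum3 by blast
    obtain x y where xy: "p = b x" "x \<in> space M V2" "q = b y" "y \<in> space M V2"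
      using N3[OF sub(1)] N3[OF sub(2)] pq by blast
    have "b v = b (x + y)" using pq(1) xy by (simp only: b.add)
    moreover have "x + y \<in> space M V2" using xy by (simp only: fvec.subspace_add[OF kron_subspace])
    ultimately have "v = x + y" using kron_inj v by (metis inj_onD)
    thus ?thesis using pq xy by blast
  qed
  have int2: "v = 0" if "v \<in> space M V2" "b v \<in> space N V3" "b v \<in> space N' V3" for v
    using that int3 kron_b_eq_0 by blast
  let ?K = "M\<lparr>space := kron_lift N\<rparr>" and ?K' = "M\<lparr>space := kron_lift N'\<rparr>"
  note K = kron_lift_submodule[OF sub(1)] and K' = kron_lift_submodule[OF sub(2)]
  have "direct_sum_of M ?K ?K'"
    unfolding direct_sum_of_def
  proof (intro conjI allI K K')
    fix x
    show "space M x = {u + v |u v. u \<in> space ?K x \<and> v \<in> space ?K' x}" (is "_ = ?S")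
    proof
      show "?S \<subseteq> space M x"
        using submodule_subset[OF K, of x] submodule_subset[OF K', of x] fvec.subspace_add[OF kron_subspace]
        by blast
      show "space M x \<subseteq> ?S"
      proof
        fix v assume v: "v \<in> space M x"
        show "v \<in> ?S"
        proof (cases x)
          case 1: V1
          hence "v = 0 + 0" using v V1 by simp
          thus ?thesis using 1 by (auto simp: kron_lift_def)
        next
          case V2
          thus ?thesis using v split2[of v] by (auto simp: kron_lift_def)
        next
          case V3
          hence "v \<in> space M V3" using v by simp
          then obtain y z where yz: "v = b y + c z" "y \<in> space M V2" "z \<in> space M V2"
            using v unfolding kron_V3 by blast
          obtain y1 y2 where y: "y = y1 + y2" "y1 \<in> space M V2" "b y1 \<in> space N V3" "y2 \<in> space M V2" "b y2 \<in> space N' V3"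
            using split2[OF yz(2)] by blast
          obtain z1 z2 where z: "z = z1 + z2" "z1 \<in> space M V2" "b z1 \<in> space N V3" "z2 \<in> space M V2" "b z2 \<in> space N' V3"
            using split2[OF yz(3)] by blast
          have "v = (b y1 + c z1) + (b y2 + c z2)"
            unfolding yz(1) y(1) z(1) by (simp only: b.add c.add ac_simps)
          moreover have "b y1 + c z1 \<in> space ?K x" "b y2 + c z2 \<in> space ?K' x"
            using V3 y z by (auto simp: kron_lift_def)
          ultimately show ?thesis by blast
        qed
      qed
    qed
    show "space ?K x \<inter> space ?K' x = {0}"
    proof
      show "{0} \<subseteq> space ?K x \<inter> space ?K' x"
        using is_module_zero[OF submodule_is_module[OF K], of x] is_module_zero[OF submodule_is_module[OF K'], of x]
        by simp
      show "space ?K x \<inter> space ?K' x \<subseteq> {0}"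
      proof
        fix v assume v: "v \<in> space ?K x \<inter> space ?K' x"
        show "v \<in> {0}"
        proof (cases x)
          case 1: V1
          thus ?thesis using v by (simp add: kron_lift_def)
        next
          case V2
          thus ?thesis using v int2[of v] by (simp add: kron_lift_def)
        next
          case V3
          obtain y1 z1 where 1: "v = b y1 + c z1" "y1 \<in> space M V2" "b y1 \<in> space N V3" "z1 \<in> space M V2" "b z1 \<in> space N V3"
            using v V3 by (auto simp: kron_lift_def)
          obtain y2 z2 where 2: "v = b y2 + c z2" "y2 \<in> space M V2" "b y2 \<in> space N' V3" "z2 \<in> space M V2" "b z2 \<in> space N' V3"
            using v V3 by (auto simp: kron_lift_def)
          \<comment> \<open>Comparing the two expressions for \<open>v\<close> places
            \<open>z1 - z2\<close> at vertex 2 of \<open>kron_sub M\<close>, where \<open>N\<close>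
            and \<open>N'\<close> split it.\<close>
          have "c (z1 - z2) = b (y2 - y1)"
            using 1(1) 2(1) unfolding b.diff c.diff by (metis add_diff_cancel_left add_diff_cancel_right' add.commute diff_diff_eq2 diff_add_eq)
          moreover have "y2 - y1 \<in> space M V2" "z1 - z2 \<in> space M V2"
            using 1 2 by (simp_all only: fvec.subspace_diff[OF kron_subspace])
          ultimately have "z1 - z2 \<in> {v \<in> space M V2. c v \<in> b ` space M V2}" by blast
          then obtain w1 w2 where w: "z1 - z2 = w1 + w2" "w1 \<in> space N V2" "w2 \<in> space N' V2"
            unfolding sum2 by blast
          note w1 = N2[OF sub(1) w(2)] and w2 = N2[OF sub(2) w(3)]
          \<comment> \<open>The map \<open>b\<close> sends the left side into \<open>N\<close> and
            the right side into \<open>N'\<close>, so both sides vanish. Then \<open>z1\<close> and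
            \<open>z2\<close> come from vertex 2 of \<open>N\<close> and \<open>N'\<close>, and
            \<open>c\<close> keeps them inside these modules.\<close>
          have eq: "z1 - w1 = z2 + w2" using w(1) by (metis add.commute add_diff_cancel_right' diff_add_cancel diff_diff_eq2 diff_add_eq)
          have "z1 - w1 = 0"
          proof (rule int2)
            show "z1 - w1 \<in> space M V2" using 1(4) w1 by (simp only: fvec.subspace_diff[OF kron_subspace])
            show "b (z1 - w1) \<in> space N V3" unfolding b.diff using 1(5) w1
              by (simp only: fvec.subspace_diff[OF is_module_subspace[OF NM(1)]])
            show "b (z1 - w1) \<in> space N' V3" unfolding eq b.add using 2(5) w2
              by (simp only: fvec.subspace_add[OF is_module_subspace[OF NM(2)]])
          qed
          hence z: "z1 = w1" "z2 = - w2" using eq by (metis eq_iff_diff_eq_0, metis add_eq_0_iff2)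
          have "v \<in> space N V3" unfolding 1(1) z(1) using 1(3) w1
            by (simp only: fvec.subspace_add[OF is_module_subspace[OF NM(1)]])
          moreover have "v \<in> space N' V3" unfolding 2(1) z(2) c.neg using 2(3) w2
            by (simp only: fvec.subspace_add[OF is_module_subspace[OF NM(2)]] fvec.subspace_neg[OF is_module_subspace[OF NM(2)]])
          ultimately show ?thesis using int3 by blast
        qed
      qed
    qed
  qed
  \<comment> \<open>A nonzero vector at vertex 2 of \<open>L\<close> already lies in the lift; one
    at vertex 3 has a nonzero preimage under \<open>b\<close> there.\<close>
  moreover have "nonzero (M\<lparr>space := kron_lift L\<rparr>)" if L: "submodule L (kron_sub M)" "nonzero L" for L
  proof -
    obtain x v where v: "v \<in> space L x" "v \<noteq> 0"
      using L(2) unfolding nonzero_iff[OF submodule_is_module[OF L(1)]] by blast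
    have "\<exists>w \<in> kron_lift L V2. w \<noteq> 0"
    proof (cases x)
      case 1: V1
      thus ?thesis using v submodule_subset[OF L(1), of V1] by (auto simp: space_kron_sub(1))
    next
      case V2
      thus ?thesis using v N2[OF L(1), of v] by (auto simp: kron_lift_def)
    next
      case V3
      then obtain w where "v = b w" "w \<in> space M V2" using v(1) N3[OF L(1)] by blast
      thus ?thesis using v V3 b.zero by (intro bexI[of _ w]) (auto simp: kron_lift_def)
    qed
    thus ?thesis unfolding nonzero_iff[OF submodule_is_module[OF kron_lift_submodule[OF L(1)]]]
      by (intro exI[of _ V2]) simp
  qed
  ultimately show False using ind nz sub unfolding indecomposable_def by blast
qed

lemma kron_sub_indecomposable: "indecomposable (kron_sub M)"
proof -
  obtain v where v: "v \<in> space M V2" "v \<noteq> 0"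
    using V2 is_module_zero[OF kron_module, of V2] by blast
  have "b v \<in> space (kron_sub M) V3" "b v \<noteq> 0"
    using v kron_b_eq_0 by (auto simp: space_kron_sub')
  hence "nonzero (kron_sub M)"
    unfolding nonzero_iff[OF submodule_is_module[OF kron_sub_submodule]] by blast
  thus ?thesis
    using submodule_is_module[OF kron_sub_submodule] kron_sub_no_decomposition
    unfolding indecomposable_def by blast
qed

lemma kron_sub_eigenvector_free: "eigenvector_free (kron_sub M)"
  using free submodule_subset[OF kron_sub_submodule, of V2]
  unfolding eigenvector_free_def act_kron_sub by blast

lemma dim_kron_sub_V3: "fvec.dim (space (kron_sub M) V3) = fvec.dim (space M V2)"
  unfolding space_kron_sub' by (rule dim_image_inj_on[OF linb is_module_fin_dim[OF kron_module] kron_inj])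

text \<open>Let W be the space of \<open>kron_sub M\<close> at vertex 2. Since W consists of the
  vectors that \<open>c\<close> sends into the image of \<open>b\<close>, and both images together
  fill vertex 3, \<open>c\<close> induces an isomorphism from the quotient of
  \<open>space M V2\<close> by W onto the quotient of \<open>space M V3\<close> by the image of
  \<open>b\<close>. Here both are lines.\<close>

lemma kron_dim_V3:
  assumes "fvec.dim (space M V2) = Suc (fvec.dim (space (kron_sub M) V2))"
  shows "fvec.dim (space M V3) = Suc (fvec.dim (space M V2))"
proof -
  let ?W = "space (kron_sub M) V2"
  have W: "?W \<subseteq> space M V2" "fvec.subspace ?W" "fin_dim_subspace ?W"
    using submodule_subset[OF kron_sub_submodule] submodule_is_module[OF kron_sub_submodule]
    by (simp_all add: is_module_subspace is_module_fin_dim)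
  have "?W \<noteq> space M V2" using assms by auto
  then obtain v where v: "v \<in> space M V2" "v \<notin> ?W" using W by blast
  have "fvec.span (insert v ?W) = space M V2"
  proof (rule subspace_eqI_dim[OF is_module_fin_dim[OF kron_module]])
    show "fvec.span (insert v ?W) \<subseteq> space M V2"
      using v W(1) by (intro fvec.span_minimal kron_subspace) auto
    show "fvec.dim (space M V2) \<le> fvec.dim (fvec.span (insert v ?W))"
      using dim_insert_span[OF W(3) v(2)] assms by simp
  qed simp
  hence dec: "\<exists>k. y - fscale k v \<in> ?W" if "y \<in> space M V2" for y
    using that span_insert_subspace[OF W(2)] by blast
  have I: "fvec.subspace (b ` space M V2)" "fin_dim_subspace (b ` space M V2)"
    using b.subspace_image[OF kron_subspace] fin_dim_subspace_image[OF linb is_module_fin_dim[OF kron_module]] .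
  have "space M V3 = fvec.span (insert (c v) (b ` space M V2))"
  proof
    show "fvec.span (insert (c v) (b ` space M V2)) \<subseteq> space M V3"
      using kron_closed v by (intro fvec.span_minimal kron_subspace) auto
    show "space M V3 \<subseteq> fvec.span (insert (c v) (b ` space M V2))"
    proof
      fix u assume "u \<in> space M V3"
      then obtain x y where u: "u = b x + c y" "x \<in> space M V2" "y \<in> space M V2"
        unfolding kron_V3 by blast
      obtain k where "y - fscale k v \<in> ?W" using dec[OF u(3)] ..
      hence "c (y - fscale k v) \<in> b ` space M V2" by (simp add: space_kron_sub')
      hence "b x + c (y - fscale k v) \<in> b ` space M V2"
        using fvec.subspace_add[OF I(1) imageI[OF u(2)]] by blast
      moreover have "b x + c (y - fscale k v) = u - fscale k (c v)"
        unfolding u(1) c.diff c.scale by (simp only: add_diff_eq)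
      ultimately show "u \<in> fvec.span (insert (c v) (b ` space M V2))"
        using span_insert_subspace[OF I(1)] by metis
    qed
  qed
  moreover have "c v \<notin> b ` space M V2" using v by (simp add: space_kron_sub')
  ultimately show ?thesis
    using dim_insert_span[OF I(2)] dim_kron_sub_V3 by (simp add: space_kron_sub')
qed

end

text \<open>If \<open>c\<close> mapped all of \<open>space M V2\<close> into the image of
  \<open>b\<close>, then following \<open>c\<close> by the inverse of \<open>b\<close> would be an
  endomorphism of \<open>space M V2\<close>. An eigenvector \<open>w\<close> of it satisfies
  \<open>c w = fscale k (b w)\<close>, a forbidden relation. Algebraic closedness enters
  here.\<close>

lemma kron_sub_proper:
  fixes M :: "'k::alg_closed_field rep"
  assumes ind: "indecomposable M" and V1: "space M V1 = {0}" and free: "eigenvector_free M"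
    and V2: "space M V2 \<noteq> {0}"
    and linb: "Vector_Spaces.linear fscale fscale b"
    and linc: "Vector_Spaces.linear fscale fscale c"
    and eqb: "\<forall>v\<in>space M V2. act M Beta v = b v"
    and eqc: "\<forall>v\<in>space M V2. act M Gamma v = c v"
  shows "space (kron_sub M) V2 \<noteq> space M V2"
proof
  assume eq: "space (kron_sub M) V2 = space M V2"
  note ctxt = ind V1 free V2 linb linc eqb eqc
  have M: "is_module M" using ind by (rule indecomposable_is_module)
  obtain h where h: "h ` UNIV \<subseteq> space M V2" "Vector_Spaces.linear fscale fscale h"
    "\<forall>v\<in>space M V2. h (b v) = v"
    using fvec_pair.linear_exists_left_inverse_on[OF linb is_module_subspace[OF M] kron_inj[OF ctxt]] by metis
  have cb: "c v \<in> b ` space M V2" if "v \<in> space M V2" for v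
    using that eq space_kron_sub'(1)[OF ctxt] by blast
  obtain v where v: "v \<in> space M V2" "v \<noteq> 0" using V2 is_module_zero[OF M, of V2] by blast
  have "Vector_Spaces.linear fscale fscale (h \<circ> c)"
    by (rule Vector_Spaces.linear_compose[OF linc h(2)])
  moreover have "(h \<circ> c) ` space M V2 \<subseteq> space M V2" using h(1) by auto
  ultimately obtain w k where w: "w \<in> space M V2" "w \<noteq> 0" "(h \<circ> c) w = fscale k w"
    using eigenvector_exists[OF _ is_module_fin_dim[OF M] _ v] by metis
  obtain y where y: "c w = b y" "y \<in> space M V2" using cb[OF w(1)] by blast
  have "y = fscale k w" using w(3) y h(3) by simp
  interpret b: Vector_Spaces.linear fscale fscale b by (rule linb)
  have "c w = fscale k (b w)" using y(1) \<open>y = fscale k w\<close> by (simp only: b.scale)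
  hence "fscale k (b w) + fscale (- 1) (c w) = 0"
    by (simp only: fvec.scale_minus_left fvec.scale_one right_minus)
  thus False using kron_free[OF ctxt w(1), of k "- 1"] w(2) by simp
qed

section \<open>Measures of modules without eigenvectors\<close>

definition preprojective_measure :: "nat \<Rightarrow> nat set" where
  "preprojective_measure n = (\<lambda>i. 2 * i + 1) ` {..n}"

lemma preprojective_measure_0: "preprojective_measure 0 = {1}"
  by (simp add: preprojective_measure_def)

lemma preprojective_measure_Suc:
  "preprojective_measure (Suc n) = insert (2 * n + 3) (preprojective_measure n)"
  by (simp add: preprojective_measure_def atMost_Suc numeral_3_eq_3)

text \<open>Dimensions and chain are proved together: the equation for \<open>kron_sub M\<close>
  yields the one for \<open>M\<close>, and only then is the length known that \<open>M\<close>
  contributes to the chain. If vertex 2 vanishes, the module is simple at vertex 3.\<close>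

lemma eigenvector_free_structure:
  fixes M :: "'k::alg_closed_field rep"
  assumes "indecomposable M" "space M V1 = {0}" "eigenvector_free M"
  shows "fvec.dim (space M V3) = Suc (fvec.dim (space M V2)) \<and>
    preprojective_measure (fvec.dim (space M V2)) \<in> chain_length_sets M"
  using assms
proof (induction "fvec.dim (space M V2)" arbitrary: M rule: less_induct)
  case less
  have M: "is_module M" using less.prems(1) by (rule indecomposable_is_module)
  have d1: "fvec.dim (space M V1) = 0" unfolding less.prems(2) by (rule dim_zero)
  show ?case
  proof (cases "space M V2 = {0}")
    case True
    hence d2: "fvec.dim (space M V2) = 0" by (simp add: dim_zero)
    have "space M V3 \<noteq> {0}"
      using less.prems(1,2) True unfolding indecomposable_def nonzero_def by (metis vertex.exhaust)
    then obtain v where v: "v \<in> space M V3" "v \<noteq> 0" using is_module_zero[OF M, of V3] by blast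
    have "total_dim M = 1"
    proof (rule split_simple[OF less.prems(1) v(1), where D = "{0}"])
      show "act M a v = 0" if "src a = V3" for a using that by (cases a) auto
      show "act M a u \<in> {0}" if "tgt a = V3" "u \<in> space M (src a)" for a u
        using that True act_zero[OF M] by (cases a) auto
    qed (use v is_module_zero[OF M, of V3] in auto)
    thus ?thesis
      using chain_length_sets_singleton[OF less.prems(1)] d1 d2
      by (simp add: total_dim_def preprojective_measure_0)
  next
    case False
    obtain b where b: "Vector_Spaces.linear fscale fscale b" "\<forall>v\<in>space M V2. b v = act M Beta v"
      using act_extend[OF M, of Beta] by (metis src.simps(2))
    obtain c where c: "Vector_Spaces.linear fscale fscale c" "\<forall>v\<in>space M V2. c v = act M Gamma v"
      using act_extend[OF M, of Gamma] by (metis src.simps(3))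
    have eqb: "\<forall>v\<in>space M V2. act M Beta v = b v" using b(2) by simp
    have eqc: "\<forall>v\<in>space M V2. act M Gamma v = c v" using c(2) by simp
    note ctxt = less.prems False b(1) c(1) eqb eqc
    let ?M = "kron_sub M"
    have sub: "submodule ?M M" by (rule kron_sub_submodule[OF ctxt])
    have neq: "space ?M V2 \<noteq> space M V2" by (rule kron_sub_proper[OF ctxt])
    have "fvec.dim (space ?M V2) < fvec.dim (space M V2)"
    proof (rule ccontr)
      assume "\<not> ?thesis"
      hence "space ?M V2 = space M V2"
        using submodule_is_module[OF sub]
        by (intro subspace_eqI_dim[OF is_module_fin_dim[OF M] _ submodule_subset[OF sub]])
          (simp_all add: is_module_subspace)
      thus False using neq by simp
    qed
    hence IH: "fvec.dim (space ?M V3) = Suc (fvec.dim (space ?M V2))"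
      "preprojective_measure (fvec.dim (space ?M V2)) \<in> chain_length_sets ?M"
      using less.hyps[OF _ kron_sub_indecomposable[OF ctxt] space_kron_sub(1) kron_sub_eigenvector_free[OF ctxt]]
      by blast+
    \<comment> \<open>Vertex 3 of the submodule is a copy of \<open>space M V2\<close>, so the
      induction hypothesis forces codimension one at vertex 2.\<close>
    have d2: "fvec.dim (space M V2) = Suc (fvec.dim (space ?M V2))"
      using IH(1) dim_kron_sub_V3[OF ctxt] by simp
    have d3: "fvec.dim (space M V3) = Suc (fvec.dim (space M V2))"
      by (rule kron_dim_V3[OF ctxt d2])
    have "total_dim M = 2 * fvec.dim (space ?M V2) + 3" using d1 d2 d3 by (simp add: total_dim_def)
    moreover have "insert (total_dim M) (preprojective_measure (fvec.dim (space ?M V2))) \<in> chain_length_sets M"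
      using neq by (intro chain_length_sets_insert[OF IH(2) sub less.prems(1)]) auto
    ultimately have "preprojective_measure (fvec.dim (space M V2)) \<in> chain_length_sets M"
      unfolding d2 preprojective_measure_Suc by metis
    with d3 show ?thesis by blast
  qed
qed

text \<open>Indecomposable submodules satisfy the same hypotheses, so each has length
  \<open>2 * m + 1\<close> with \<open>m\<close> bounded by the dimension at vertex 2. The set of
  any chain is therefore contained in the one already found.\<close>

lemma gr_measure_eigenvector_free:
  fixes M :: "'k::alg_closed_field rep"
  assumes "indecomposable M" "space M V1 = {0}" "eigenvector_free M"
  shows "gr_measure M = preprojective_measure (fvec.dim (space M V2))"
proof (rule gr_measure_eqI[OF assms(1)])
  have M: "is_module M" using assms(1) by (rule indecomposable_is_module)
  show "preprojective_measure (fvec.dim (space M V2)) \<in> chain_length_sets M"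
    using eigenvector_free_structure[OF assms] ..
  show "J \<subseteq> preprojective_measure (fvec.dim (space M V2))" if J: "J \<in> chain_length_sets M" for J
  proof
    fix n assume "n \<in> J"
    then obtain N where N: "submodule N M" "indecomposable N" "n = total_dim N"
      using J by (meson chain_length_sets_elem)
    have N1: "space N V1 = {0}"
      using submodule_subset[OF N(1), of V1] assms(2) is_module_zero[OF submodule_is_module[OF N(1)], of V1] by auto
    have "eigenvector_free N"
      using assms(3) submodule_subset[OF N(1), of V2] submodule_act[OF N(1)]
      unfolding eigenvector_free_def by (metis subsetD)
    hence "fvec.dim (space N V3) = Suc (fvec.dim (space N V2))"
      using eigenvector_free_structure[OF N(2) N1] by blast
    hence "n = 2 * fvec.dim (space N V2) + 1"
      using N(3) N1 by (simp add: total_dim_def dim_zero)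
    moreover have "fvec.dim (space N V2) \<le> fvec.dim (space M V2)"
      by (rule dim_submodule_le[OF N(1) M])
    ultimately show "n \<in> preprojective_measure (fvec.dim (space M V2))"
      unfolding preprojective_measure_def by blast
  qed
qed

section \<open>Examples of modules\<close>

lemma sum_eq_sum_imp_diff_eq_diff:
  fixes a b c d :: "'a::ab_group_add"
  assumes "a + b = c + d"
  shows "a - c = d - b"
proof -
  have "a - c = (a + b) - c - b" by (simp add: algebra_simps)
  thus ?thesis unfolding assms by simp
qed

text \<open>Read as coefficient sequences these are the polynomials of degree below
  \<open>n\<close>, and \<open>P1_act Gamma\<close> is multiplication by the variable.\<close>

definition supported_below :: "nat \<Rightarrow> (nat \<Rightarrow> 'k::field) set" where
  "supported_below n = {v. \<forall>i\<ge>n. v i = 0}"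

lemma subspace_supported_below: "fvec.subspace (supported_below n)"
  by (rule fvec.subspaceI) (simp_all add: supported_below_def fscale_def)

lemma supported_below_0: "supported_below 0 = {0}"
  by (auto simp: supported_below_def fun_eq_iff)

lemma unit_vec_neq_0: "unit_vec i \<noteq> (0 :: nat \<Rightarrow> 'k::field)"
  by (auto simp: unit_vec_def fun_eq_iff)

lemma unit_vec_supported_below: "i < n \<Longrightarrow> unit_vec i \<in> supported_below n"
  by (simp add: supported_below_def unit_vec_def)

lemma supported_below_Suc:
  "supported_below (Suc n) = fvec.span (insert (unit_vec n) (supported_below n :: (nat \<Rightarrow> 'k::field) set))"
proof (intro set_eqI)
  fix u :: "nat \<Rightarrow> 'k"
  have "u \<in> supported_below (Suc n) \<longleftrightarrow> (\<exists>k. u - fscale k (unit_vec n) \<in> supported_below n)"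
  proof
    assume u: "u \<in> supported_below (Suc n)"
    have "(u - fscale (u n) (unit_vec n)) i = 0" if "i \<ge> n" for i
      using that u by (cases "i = n") (simp_all add: supported_below_def fscale_def unit_vec_def)
    thus "\<exists>k. u - fscale k (unit_vec n) \<in> supported_below n"
      unfolding supported_below_def by blast
  next
    assume "\<exists>k. u - fscale k (unit_vec n) \<in> supported_below n"
    then obtain k where k: "\<And>i. i \<ge> n \<Longrightarrow> (u - fscale k (unit_vec n)) i = 0"
      unfolding supported_below_def by blast
    have "u i = 0" if "i \<ge> Suc n" for i
      using k[of i] that by (simp add: fscale_def unit_vec_def)
    thus "u \<in> supported_below (Suc n)" by (simp add: supported_below_def)
  qed
  thus "u \<in> supported_below (Suc n) \<longleftrightarrow> u \<in> fvec.span (insert (unit_vec n) (supported_below n))"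
    using span_insert_subspace[OF subspace_supported_below] by blast
qed

lemma supported_below_span:
  "supported_below n = fvec.span (unit_vec ` {..<n} :: (nat \<Rightarrow> 'k::field) set)"
  by (induction n) (simp_all add: supported_below_0 supported_below_Suc span_insert_span lessThan_Suc)

lemma fin_dim_supported_below: "fin_dim_subspace (supported_below n)"
  unfolding supported_below_span by (rule fin_dim_subspace_span) simp

lemma dim_supported_below: "fvec.dim (supported_below n :: (nat \<Rightarrow> 'k::field) set) = n"
proof (induction n)
  case 0
  then show ?case by (simp add: supported_below_0 dim_zero)
next
  case (Suc n)
  have "unit_vec n \<notin> (supported_below n :: (nat \<Rightarrow> 'k) set)"
    by (auto simp: supported_below_def unit_vec_def)
  then show ?case
    unfolding supported_below_Suc using dim_insert_span[OF fin_dim_supported_below, of "unit_vec n" n] Suc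
    by metis
qed

section \<open>The right shift and the preprojective Kronecker modules\<close>

lemma P1_act_Gamma_0: "P1_act Gamma v 0 = 0"
  and P1_act_Gamma_Suc: "P1_act Gamma v (Suc i) = v i"
  by simp_all

lemma linear_P1_act: "Vector_Spaces.linear fscale fscale (P1_act a :: (nat \<Rightarrow> 'k::field) \<Rightarrow> _)"
proof -
  have "P1_act a (u + v) = P1_act a u + P1_act a v \<and> P1_act a (fscale c u) = fscale c (P1_act a u)"
    for c and u v :: "nat \<Rightarrow> 'k"
    by (cases a) (auto simp: fun_eq_iff fscale_def split: nat.split)
  thus ?thesis unfolding Vector_Spaces.linear_iff by (simp add: fvec.vector_space_axioms)
qed

lemma linear_imp_linear_map:
  assumes "Vector_Spaces.linear fscale fscale f" "f ` U \<subseteq> W"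
  shows "linear_map U W f"
proof -
  interpret f: Vector_Spaces.linear fscale fscale f by (rule assms(1))
  show ?thesis unfolding linear_map_def using assms(2) f.add f.scale by blast
qed

text \<open>Let \<open>i\<close> be the first index with a nonzero coefficient of \<open>v\<close>.
  The shifted vector starts one place later, so index \<open>i\<close> gives \<open>x = 0\<close>
  and index \<open>Suc i\<close> then gives \<open>y = 0\<close>.\<close>

lemma shift_independent:
  assumes "fscale x v + fscale y (P1_act Gamma v) = 0" "v \<noteq> 0"
  shows "x = 0 \<and> y = 0"
proof -
  have "\<exists>i. v i \<noteq> 0" using assms(2) by (auto simp: fun_eq_iff)
  then obtain i where i: "v i \<noteq> 0" "\<And>j. j < i \<Longrightarrow> v j = 0"
    using exists_least_iff[of "\<lambda>i. v i \<noteq> 0"] by blast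
  have eq: "x * v j + y * P1_act Gamma v j = 0" for j
    using fun_cong[OF assms(1), of j] by (simp add: fscale_def)
  have "P1_act Gamma v i = 0" using i(2) by (cases i) auto
  hence "x = 0" using eq[of i] i(1) by simp
  thus ?thesis using eq[of "Suc i"] i(1) by simp
qed

text \<open>Polynomials of degree below \<open>n\<close> mapped to those of degree at most
  \<open>n\<close>, with \<open>Beta\<close> the inclusion and \<open>Gamma\<close> multiplication
  by the variable. Reusing \<open>P1_act\<close> lets one independence argument serve these modules
  and \<open>P1\<close>.\<close>

definition preprojective :: "nat \<Rightarrow> 'k::field rep" where
  "preprojective n = \<lparr>space = (\<lambda>x. case x of V1 \<Rightarrow> {0} | V2 \<Rightarrow> supported_below n | V3 \<Rightarrow> supported_below (Suc n)),
     act = P1_act\<rparr>"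

lemma space_preprojective:
  "space (preprojective n) V1 = {0}"
  "space (preprojective n) V2 = supported_below n"
  "space (preprojective n) V3 = supported_below (Suc n)"
  by (simp_all add: preprojective_def)

lemma act_preprojective: "act (preprojective n) = P1_act"
  by (simp add: preprojective_def)

lemma is_module_preprojective: "is_module (preprojective n)"
  unfolding is_module_def
proof (intro conjI allI)
  show "fin_dim_subspace (space (preprojective n) x)" for x
    by (cases x) (simp_all add: space_preprojective fin_dim_subspace_zero fin_dim_supported_below)
  show "linear_map (space (preprojective n) (src a)) (space (preprojective n) (tgt a)) (act (preprojective n) a)" for a
    unfolding act_preprojective
    by (rule linear_imp_linear_map[OF linear_P1_act], cases a)
      (auto simp: space_preprojective supported_below_def split: nat.split)
qed

lemma eigenvector_free_preprojective: "eigenvector_free (preprojective n)"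
  unfolding eigenvector_free_def act_preprojective using shift_independent
  by (metis P1_act.simps(2))

lemma shift_power: "(P1_act Gamma ^^ i) v j = (if j < i then 0 else v (j - i))"
proof (induction i arbitrary: j)
  case (Suc i)
  show ?case using Suc.IH by (cases j) (simp_all add: P1_act_Gamma_0 P1_act_Gamma_Suc del: P1_act.simps)
qed simp

text \<open>A summand containing \<open>unit_vec 0\<close> at vertex 3 contains it at vertex 2 as
  well if \<open>n > 0\<close>, hence its shift \<open>unit_vec 1\<close>, and so on until vertex 3
  is exhausted. It remains to see that the components of \<open>unit_vec 0\<close> are multiples of
  it, so that one of the summands does contain it.\<close>

lemma indecomposable_preprojective: "indecomposable (preprojective n :: 'k::field rep)"
proof -
  let ?M = "preprojective n :: 'k rep" and ?X = "P1_act Gamma :: (nat \<Rightarrow> 'k) \<Rightarrow> _"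
  interpret X: Vector_Spaces.linear fscale fscale ?X by (rule linear_P1_act)
  have key: "\<not> nonzero N'"
    if ds: "direct_sum_of ?M N N'" and e0: "unit_vec 0 \<in> space N V3" for N N'
  proof -
    have sub: "submodule N ?M" "submodule N' ?M" using ds by (simp_all add: direct_sum_of_def)
    have int: "space N x \<inter> space N' x = {0}" for x using ds by (simp add: direct_sum_of_def)
    have N: "is_module N" "is_module N'" using sub by (simp_all add: submodule_is_module)
    have a: "act N = P1_act" "act N' = P1_act"
      using submodule_act[OF sub(1)] submodule_act[OF sub(2)] by (simp_all add: act_preprojective)
    have N23: "space N V2 \<subseteq> space N V3" "space N' V2 \<subseteq> space N' V3"
      using act_closed[OF N(1), of _ Beta] act_closed[OF N(2), of _ Beta] by (auto simp: a)
    have e: "unit_vec i \<in> space N V3" if "i \<le> n" for i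
      using that
    proof (induction i)
      case 0
      show ?case by (rule e0)
    next
      case (Suc i)
      have "unit_vec i \<in> space ?M V2" using Suc.prems
        by (auto simp: space_preprojective supported_below_def unit_vec_def)
      then obtain u w where uw: "unit_vec i = u + w" "u \<in> space N V2" "w \<in> space N' V2"
        using ds unfolding direct_sum_of_def by blast
      have "unit_vec i \<in> space N V3" using Suc by simp
      hence "unit_vec i - u \<in> space N V3"
        using uw(2) N23(1) by (intro fvec.subspace_diff[OF is_module_subspace[OF N(1)]]) auto
      moreover have "unit_vec i - u = w" using uw(1) by simp
      ultimately have "w = 0" using uw(3) N23(2) int[of V3] by blast
      hence "unit_vec i \<in> space N V2" using uw(1,2) by simp
      hence "?X (unit_vec i) \<in> space N V3" using act_closed[OF N(1), of "unit_vec i" Gamma] by (simp add: a)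
      moreover have "?X (unit_vec i) = unit_vec (Suc i)"
        by (auto simp: fun_eq_iff unit_vec_def split: nat.split)
      ultimately show ?case by simp
    qed
    have "supported_below (Suc n) \<subseteq> space N V3"
      unfolding supported_below_span using e
      by (intro fvec.span_minimal is_module_subspace[OF N(1)]) auto
    hence "space N' V3 \<subseteq> {0}"
      using submodule_subset[OF sub(2), of V3] int[of V3] by (auto simp: space_preprojective)
    hence "space N' x \<subseteq> {0}" for x
      using N23(2) submodule_subset[OF sub(2), of V1] by (cases x) (auto simp: space_preprojective)
    thus ?thesis unfolding nonzero_iff[OF N(2)] by blast
  qed
  have "\<not> nonzero N \<or> \<not> nonzero N'" if ds: "direct_sum_of ?M N N'" for N N'
  proof -
    have sub: "submodule N ?M" "submodule N' ?M" using ds by (simp_all add: direct_sum_of_def)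
    have int: "space N x \<inter> space N' x = {0}" for x using ds by (simp add: direct_sum_of_def)
    have N: "is_module N" "is_module N'" using sub by (simp_all add: submodule_is_module)
    have a: "act N = P1_act" "act N' = P1_act"
      using submodule_act[OF sub(1)] submodule_act[OF sub(2)] by (simp_all add: act_preprojective)
    have N23: "space N V2 \<subseteq> space N V3" "space N' V2 \<subseteq> space N' V3"
      using act_closed[OF N(1), of _ Beta] act_closed[OF N(2), of _ Beta] by (auto simp: a)
    have "unit_vec 0 \<in> space ?M V3"
      by (auto simp: space_preprojective supported_below_def unit_vec_def)
    then obtain u w where uw: "unit_vec 0 = u + w" "u \<in> space N V3" "w \<in> space N' V3"
      using ds unfolding direct_sum_of_def by blast
    \<comment> \<open>For \<open>i < n\<close> the \<open>i\<close>-fold shift of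
      \<open>unit_vec 0\<close> lies at vertex 2 and splits there. Comparison with the splitting at
      vertex 3 puts both shifted components at vertex 2, where \<open>Gamma\<close> can be applied
      once more.\<close>
    have pow: "(?X ^^ i) u \<in> space N V3 \<and> (?X ^^ i) w \<in> space N' V3" if "i \<le> n" for i
      using that
    proof (induction i)
      case 0
      then show ?case using uw by simp
    next
      case (Suc i)
      have "(?X ^^ i) (u + w) j = 0" if "j \<ge> n" for j
        using that Suc.prems unfolding shift_power uw(1)[symmetric] by (auto simp: unit_vec_def)
      hence "(?X ^^ i) (u + w) \<in> space ?M V2" unfolding space_preprojective supported_below_def by blast
      moreover have "(?X ^^ i) (u + w) = (?X ^^ i) u + (?X ^^ i) w"
        by (auto simp: fun_eq_iff shift_power)
      ultimately have "(?X ^^ i) u + (?X ^^ i) w \<in> space ?M V2" by metis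
      then obtain p q where pq: "(?X ^^ i) u + (?X ^^ i) w = p + q" "p \<in> space N V2" "q \<in> space N' V2"
        using ds unfolding direct_sum_of_def by blast
      have IH: "(?X ^^ i) u \<in> space N V3" "(?X ^^ i) w \<in> space N' V3"
        using Suc by (simp_all del: P1_act.simps)
      have eq: "(?X ^^ i) u - p = q - (?X ^^ i) w"
        by (rule sum_eq_sum_imp_diff_eq_diff[OF pq(1)])
      have "(?X ^^ i) u - p \<in> space N V3"
        using IH(1) pq(2) N23(1) by (intro fvec.subspace_diff[OF is_module_subspace[OF N(1)]]) auto
      moreover have "(?X ^^ i) u - p \<in> space N' V3"
        unfolding eq using IH(2) pq(3) N23(2)
        by (intro fvec.subspace_diff[OF is_module_subspace[OF N(2)]]) auto
      ultimately have 0: "(?X ^^ i) u - p = 0" using int[of V3] by blast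
      hence "(?X ^^ i) u = p" by (rule iffD1[OF right_minus_eq])
      moreover have "q = (?X ^^ i) w" using 0 unfolding eq by (rule iffD1[OF right_minus_eq])
      ultimately show ?case
        using act_closed[OF N(1), of p Gamma] act_closed[OF N(2), of q Gamma] pq(2,3)
        by (simp add: a del: P1_act.simps)
    qed
    \<comment> \<open>After \<open>n\<close> shifts \<open>u\<close> still has no coefficient beyond
      index \<open>n\<close>, so \<open>u\<close> has none beyond index 0.\<close>
    have "(?X ^^ n) u \<in> supported_below (Suc n)"
      using pow[of n] submodule_subset[OF sub(1), of V3] by (auto simp: space_preprojective)
    hence "(?X ^^ n) u (i + n) = 0" if "i > 0" for i
      using that by (simp add: supported_below_def)
    hence ui: "u i = 0" if "i > 0" for i using that by (simp add: shift_power)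
    hence u: "u = fscale (u 0) (unit_vec 0)"
      by (auto simp: fun_eq_iff fscale_def unit_vec_def)
    show ?thesis
    proof (cases "u 0 = 0")
      case True
      hence "u = 0" using u by (metis fvec.scale_zero_left)
      hence "unit_vec 0 \<in> space N' V3" using uw(1,3) by simp
      moreover have "direct_sum_of ?M N' N"
        using ds unfolding direct_sum_of_def by (auto simp: Int_commute) (metis add.commute)+
      ultimately show ?thesis using key by blast
    next
      case False
      have "fscale (inverse (u 0)) u = unit_vec 0"
        using False ui by (auto simp: fun_eq_iff fscale_def unit_vec_def)
      hence "unit_vec 0 \<in> space N V3"
        using fvec.subspace_scale[OF is_module_subspace[OF N(1)] uw(2)] by metis
      thus ?thesis using key[OF ds] by blast
    qed
  qed
  moreover have "nonzero ?M"
    unfolding nonzero_iff[OF is_module_preprojective]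
    by (intro exI[of _ V3] bexI[of _ "unit_vec 0"])
      (simp_all add: unit_vec_neq_0 space_preprojective unit_vec_supported_below)
  ultimately show ?thesis using is_module_preprojective unfolding indecomposable_def by blast
qed

lemma gr_measure_preprojective:
  "gr_measure (preprojective n :: 'k::alg_closed_field rep) = preprojective_measure n"
  using gr_measure_eigenvector_free[OF indecomposable_preprojective space_preprojective(1) eigenvector_free_preprojective]
  by (simp add: space_preprojective dim_supported_below)

section \<open>The regular Kronecker modules of a nilpotent Jordan block\<close>

definition left_shift :: "(nat \<Rightarrow> 'k::field) \<Rightarrow> nat \<Rightarrow> 'k" where
  "left_shift v = (\<lambda>i. v (Suc i))"

text \<open>The left shift is a nilpotent Jordan block on \<open>supported_below n\<close>. It kills
  \<open>unit_vec 0\<close>, which is the eigenvector giving a submodule of length 2.\<close>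

definition regular :: "nat \<Rightarrow> 'k::field rep" where
  "regular n = \<lparr>space = (\<lambda>x. case x of V1 \<Rightarrow> {0} | V2 \<Rightarrow> supported_below n | V3 \<Rightarrow> supported_below n),
     act = (\<lambda>a. case a of Alpha \<Rightarrow> id | Beta \<Rightarrow> id | Gamma \<Rightarrow> left_shift)\<rparr>"

lemma space_regular:
  "space (regular n) V1 = {0}"
  "space (regular n) V2 = supported_below n"
  "space (regular n) V3 = supported_below n"
  by (simp_all add: regular_def)

lemma act_regular: "act (regular n) Beta = id" "act (regular n) Gamma = left_shift"
  by (simp_all add: regular_def)

lemma is_module_regular: "is_module (regular n :: 'k::field rep)"
  unfolding is_module_def
proof (intro conjI allI)
  show "fin_dim_subspace (space (regular n :: 'k rep) x)" for x
    by (cases x) (simp_all add: space_regular fin_dim_subspace_zero fin_dim_supported_below)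
  show "linear_map (space (regular n :: 'k rep) (src a)) (space (regular n) (tgt a)) (act (regular n) a)" for a
    by (cases a) (auto simp: regular_def linear_map_def supported_below_def left_shift_def fun_eq_iff fscale_def)
qed

text \<open>Shifting a nonzero vector of finite support to the left as long as it stays nonzero ends
  at a nonzero multiple of \<open>unit_vec 0\<close>.\<close>

lemma socle_left_shift:
  assumes "fvec.subspace U" "\<And>v. v \<in> U \<Longrightarrow> left_shift v \<in> U"
  shows "v \<in> U \<Longrightarrow> v \<noteq> 0 \<Longrightarrow> v \<in> supported_below m \<Longrightarrow> unit_vec 0 \<in> U"
proof (induction m arbitrary: v)
  case 0
  then show ?case by (simp add: supported_below_0)
next
  case (Suc m)
  show ?case
  proof (cases "left_shift v = 0")
    case True
    hence z: "v (Suc i) = 0" for i by (simp add: left_shift_def fun_eq_iff)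
    have "v 0 \<noteq> 0"
    proof
      assume "v 0 = 0"
      hence "v i = 0" for i using z by (cases i) auto
      thus False using Suc.prems(2) by (auto simp: fun_eq_iff)
    qed
    moreover from this have "fscale (inverse (v 0)) v i = unit_vec 0 i" for i
      using z by (cases i) (simp_all add: fscale_def unit_vec_def)
    hence "fscale (inverse (v 0)) v = unit_vec 0" by blast
    ultimately show ?thesis
      using fvec.subspace_scale[OF assms(1) Suc.prems(1)] by metis
  next
    case False
    have "left_shift v \<in> supported_below m" using Suc.prems(3) by (simp add: supported_below_def left_shift_def)
    thus ?thesis using Suc.IH[OF assms(2)[OF Suc.prems(1)] False] by blast
  qed
qed

text \<open>Vertex 3 of each nonzero summand is invariant under the left shift and so contains
  \<open>unit_vec 0\<close>; two such summands cannot be complementary.\<close>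

lemma indecomposable_regular:
  assumes "n > 0"
  shows "indecomposable (regular n :: 'k::field rep)"
proof -
  let ?M = "regular n :: 'k rep"
  have False if ds: "direct_sum_of ?M N N'" and nz: "nonzero N" "nonzero N'" for N N'
  proof -
    have socle: "unit_vec 0 \<in> space K V3"
      if ds: "direct_sum_of ?M K K'" and nz: "nonzero K" for K K'
    proof -
      have sub: "submodule K ?M" "submodule K' ?M" using ds by (simp_all add: direct_sum_of_def)
      have K: "is_module K" "is_module K'" using sub by (simp_all add: submodule_is_module)
      have a: "act K = act ?M" "act K' = act ?M"
        using submodule_act[OF sub(1)] submodule_act[OF sub(2)] by simp_all
      have K23: "space K V2 \<subseteq> space K V3" "space K' V2 \<subseteq> space K' V3"
        using act_closed[OF K(1), of _ Beta] act_closed[OF K(2), of _ Beta] by (auto simp: a act_regular)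
      \<comment> \<open>As \<open>Beta\<close> is the identity, each summand has the same space at
        vertices 2 and 3. This turns the action of \<open>Gamma\<close> into an endomorphism of
        \<open>space K V3\<close>.\<close>
      have K32: "u \<in> space K V2" if u: "u \<in> space K V3" for u
      proof -
        have "u \<in> space ?M V2" using u submodule_subset[OF sub(1), of V3] by (auto simp: space_regular)
        then obtain p q where pq: "u = p + q" "p \<in> space K V2" "q \<in> space K' V2"
          using ds unfolding direct_sum_of_def by blast
        have "u - p \<in> space K V3"
          using u pq(2) K23(1) by (intro fvec.subspace_diff[OF is_module_subspace[OF K(1)]]) auto
        moreover have "u - p = q" using pq(1) by simp
        moreover have "space K V3 \<inter> space K' V3 = {0}" using ds by (simp add: direct_sum_of_def)
        ultimately have "q = 0" using pq(3) K23(2) by blast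
        thus ?thesis using pq by simp
      qed
      obtain x v where v: "v \<in> space K x" "v \<noteq> 0" using nz unfolding nonzero_iff[OF K(1)] by blast
      have v3: "v \<in> space K V3"
        using v submodule_subset[OF sub(1), of V1] K23(1) by (cases x) (auto simp: space_regular)
      show ?thesis
      proof (rule socle_left_shift[OF is_module_subspace[OF K(1)] _ v3 v(2)])
        show "left_shift u \<in> space K V3" if "u \<in> space K V3" for u
          using act_closed[OF K(1), of u Gamma] K32[OF that] by (simp add: a act_regular)
        show "v \<in> supported_below n" using v3 submodule_subset[OF sub(1), of V3] by (auto simp: space_regular)
      qed
    qed
    have "direct_sum_of ?M N' N"
      using ds unfolding direct_sum_of_def by (auto simp: Int_commute) (metis add.commute)+
    hence "unit_vec 0 \<in> space N V3 \<inter> space N' V3" using socle ds nz by blast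
    thus False using ds unit_vec_neq_0 unfolding direct_sum_of_def by blast
  qed
  moreover have "nonzero ?M"
    unfolding nonzero_iff[OF is_module_regular] using assms
    by (intro exI[of _ V3] bexI[of _ "unit_vec 0"])
      (simp_all add: unit_vec_neq_0 space_regular unit_vec_supported_below)
  ultimately show ?thesis using is_module_regular unfolding indecomposable_def by blast
qed

lemma total_dim_regular: "total_dim (regular n) = 2 * n"
  by (simp add: total_dim_def space_regular dim_zero dim_supported_below)

lemma chain_one_two_regular:
  assumes "n > 0"
  shows "{1, 2} \<in> chain_length_sets (regular n :: 'k::field rep)"
proof (rule chain_one_two[OF is_module_regular])
  show "unit_vec 0 \<in> space (regular n :: 'k rep) V2"
    using assms by (auto simp: space_regular supported_below_def unit_vec_def)
  have "left_shift (unit_vec 0 :: nat \<Rightarrow> 'k) = 0"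
    by (simp add: left_shift_def unit_vec_def fun_eq_iff)
  thus "fscale 0 (act (regular n) Beta (unit_vec 0 :: nat \<Rightarrow> 'k)) + fscale 1 (act (regular n) Gamma (unit_vec 0)) = 0"
    unfolding act_regular by (simp only: fvec.scale_zero_left fvec.scale_zero_right add_0_left)
qed (simp_all add: unit_vec_neq_0 act_regular)

section \<open>The projective module and its measure\<close>

lemma space_P1:
  "space (P1 :: 'k::field rep) V1 = fvec.span {unit_vec 0}"
  "space (P1 :: 'k rep) V2 = fvec.span {unit_vec 0}"
  "space (P1 :: 'k rep) V3 = fvec.span {unit_vec 0, unit_vec 1}"
  by (simp_all add: P1_def)

lemma act_P1: "act P1 = P1_act"
  by (simp add: P1_def)

lemma P1_act_Gamma_unit_vec: "P1_act Gamma (unit_vec i) = unit_vec (Suc i)"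
  by (auto simp: fun_eq_iff unit_vec_def split: nat.split)

lemma is_module_P1: "is_module (P1 :: 'k::field rep)"
  unfolding is_module_def
proof (intro conjI allI)
  show "fin_dim_subspace (space (P1 :: 'k rep) x)" for x
    by (cases x) (simp_all only: space_P1 fin_dim_subspace_span finite.intros)
  have "P1_act a ` fvec.span {unit_vec 0} \<subseteq> space (P1 :: 'k rep) (tgt a)" for a
  proof -
    interpret l: Vector_Spaces.linear fscale fscale "P1_act a :: (nat \<Rightarrow> 'k) \<Rightarrow> _" by (rule linear_P1_act)
    have "P1_act a ` fvec.span {unit_vec 0 :: nat \<Rightarrow> 'k} = fvec.span {P1_act a (unit_vec 0)}"
      using l.span_image[of "{unit_vec 0}"] by simp
    also have "\<dots> \<subseteq> space (P1 :: 'k rep) (tgt a)"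
      by (cases a) (simp_all add: space_P1 fvec.span_mono P1_act_Gamma_unit_vec del: P1_act.simps(3))
    finally show ?thesis .
  qed
  moreover have "space (P1 :: 'k rep) (src a) = fvec.span {unit_vec 0}" for a
    by (cases a) (simp_all add: space_P1)
  ultimately show "linear_map (space (P1 :: 'k rep) (src a)) (space P1 (tgt a)) (act P1 a)" for a
    unfolding act_P1 by (metis linear_imp_linear_map linear_P1_act)
qed

lemma P1_generated: "gen P1 V1 (unit_vec 0) = P1"
proof (rule rep.equality)
  have "gen_space P1 V1 (unit_vec 0) x = space P1 x" for x
    by (cases x) (simp_all add: space_P1 act_P1 P1_act_Gamma_unit_vec del: P1_act.simps(3))
  thus "space (gen P1 V1 (unit_vec 0)) = space P1" unfolding space_gen by blast
qed simp_all

lemma unit_vec_in_P1: "unit_vec 0 \<in> space P1 V1"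
  by (simp add: space_P1 fvec.span_base)

lemma indecomposable_P1: "indecomposable P1"
  using gen_indecomposable[OF is_module_P1 unit_vec_in_P1 unit_vec_neq_0] by (simp add: P1_generated)

lemma dim_vector_P1: "dim_vector (P1 :: 'k::field rep) = (1, 1, 2)"
proof -
  have "fvec.span {unit_vec 0, unit_vec 1 :: nat \<Rightarrow> 'k} = supported_below 2"
    unfolding supported_below_span by (simp add: lessThan_Suc numeral_2_eq_2 insert_commute)
  moreover have "fvec.span {unit_vec 0 :: nat \<Rightarrow> 'k} = supported_below 1"
    unfolding supported_below_span by (simp add: lessThan_Suc)
  ultimately show ?thesis by (simp only: dim_vector_def space_P1 dim_supported_below)
qed

lemma total_dim_P1: "total_dim (P1 :: 'k::field rep) = 4"
  using dim_vector_P1[where 'k = 'k] by (simp add: dim_vector_def total_dim_def)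

lemma eigenvector_free_P1: "eigenvector_free P1"
  unfolding eigenvector_free_def act_P1 using shift_independent by (metis P1_act.simps(2))

section \<open>Projectivity of \<open>P1\<close> through its universal property\<close>

fun P1_hom :: "'k::field rep \<Rightarrow> (nat \<Rightarrow> 'k) \<Rightarrow> vertex \<Rightarrow> (nat \<Rightarrow> 'k) \<Rightarrow> (nat \<Rightarrow> 'k)" where
  "P1_hom M m V1 v = fscale (v 0) m"
| "P1_hom M m V2 v = fscale (v 0) (act M Alpha m)"
| "P1_hom M m V3 v = fscale (v 0) (act M Beta (act M Alpha m)) + fscale (v 1) (act M Gamma (act M Alpha m))"

lemma in_P1_coordinates:
  fixes v :: "nat \<Rightarrow> 'k::field"
  assumes "v \<in> space P1 x"
  shows "x \<noteq> V3 \<Longrightarrow> v = fscale (v 0) (unit_vec 0)"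
    and "x = V3 \<Longrightarrow> v = fscale (v 0) (unit_vec 0) + fscale (v 1) (unit_vec 1)"
proof -
  have s1: "fvec.span {unit_vec 0 :: nat \<Rightarrow> 'k} = supported_below 1"
    unfolding supported_below_span by (simp add: lessThan_Suc)
  have s2: "fvec.span {unit_vec 0, unit_vec 1 :: nat \<Rightarrow> 'k} = supported_below 2"
    unfolding supported_below_span by (simp add: lessThan_Suc numeral_2_eq_2 insert_commute)
  show "v = fscale (v 0) (unit_vec 0)" if "x \<noteq> V3"
  proof -
    have "v \<in> supported_below 1" using assms that s1 by (cases x) (simp_all add: space_P1)
    thus ?thesis by (auto simp: fun_eq_iff supported_below_def fscale_def unit_vec_def)
  qed
  show "v = fscale (v 0) (unit_vec 0) + fscale (v 1) (unit_vec 1)" if "x = V3"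
  proof -
    have "v \<in> supported_below 2" using assms that s2 by (simp add: space_P1)
    hence "v i = 0" if "i \<noteq> 0" "i \<noteq> 1" for i using that by (simp add: supported_below_def)
    thus ?thesis by (auto simp: fun_eq_iff fscale_def unit_vec_def)
  qed
qed

lemma P1_hom_linear:
  "P1_hom M m x (u + v) = P1_hom M m x u + P1_hom M m x v"
  "P1_hom M m x (fscale c v) = fscale c (P1_hom M m x v)"
  by (cases x; simp add: fscale_def fun_eq_iff algebra_simps)+

lemma P1_hom_closed:
  assumes M: "is_module M" and m: "m \<in> space M V1"
  shows "P1_hom M m x v \<in> space M x"
proof -
  have a: "act M Alpha m \<in> space M V2" using act_closed[OF M, of m Alpha] m by simp
  have b: "act M Beta (act M Alpha m) \<in> space M V3" "act M Gamma (act M Alpha m) \<in> space M V3"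
    using act_closed[OF M, of _ Beta] act_closed[OF M, of _ Gamma] a by simp_all
  note S = is_module_subspace[OF M]
  show ?thesis
  proof (cases x)
    case V1
    thus ?thesis using fvec.subspace_scale[OF S m] by simp
  next
    case V2
    thus ?thesis using fvec.subspace_scale[OF S a] by simp
  next
    case V3
    thus ?thesis
      using fvec.subspace_add[OF S fvec.subspace_scale[OF S b(1)] fvec.subspace_scale[OF S b(2)]] by simp
  qed
qed

text \<open>Existence half of the universal property: the generator \<open>unit_vec 0\<close> at
  vertex 1 may be sent to any \<open>m\<close>, each basis path then going to the corresponding
  image of \<open>m\<close>.\<close>

lemma module_hom_P1_hom:
  assumes M: "is_module M" and m: "m \<in> space M V1"
  shows "module_hom P1 M (P1_hom M m)"
  unfolding module_hom_def
proof (intro conjI allI ballI)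
  show "linear_map (space P1 x) (space M x) (P1_hom M m x)" for x
    unfolding linear_map_def using P1_hom_linear[of M m x] P1_hom_closed[OF M m, of x] by blast
  fix a and v :: "nat \<Rightarrow> 'a"
  assume v: "v \<in> space P1 (src a)"
  have am: "act M Alpha m \<in> space M V2" using act_closed[OF M, of m Alpha] m by simp
  have z: "v 1 = 0"
  proof -
    have "src a \<noteq> V3" by (cases a) auto
    from fun_cong[OF in_P1_coordinates(1)[OF v this], of 1] show ?thesis
      by (simp add: fscale_def unit_vec_def)
  qed
  show "P1_hom M m (tgt a) (act P1 a v) = act M a (P1_hom M m (src a) v)"
  proof (cases a)
    case Alpha
    thus ?thesis using act_scale[OF M, of m Alpha "v 0"] m by (simp add: act_P1)
  next
    case Beta
    have "P1_hom M m V3 v = fscale (v 0) (act M Beta (act M Alpha m))"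
      unfolding P1_hom.simps z by (simp only: fvec.scale_zero_left add_0_right)
    thus ?thesis using Beta act_scale[OF M, of "act M Alpha m" Beta "v 0"] am by (simp add: act_P1)
  next
    case Gamma
    have "P1_hom M m V3 (P1_act Gamma v) = fscale (v 0) (act M Gamma (act M Alpha m))"
      unfolding P1_hom.simps P1_act_Gamma_0 One_nat_def P1_act_Gamma_Suc
      by (simp only: fvec.scale_zero_left add_0_left)
    thus ?thesis using Gamma act_scale[OF M, of "act M Alpha m" Gamma "v 0"] am
      by (simp add: act_P1 del: P1_act.simps(3))
  qed
qed

text \<open>Uniqueness half: the arrows carry the generator at vertex 1 to the basis vectors at the
  other vertices, so its image determines a homomorphism.\<close>

lemma module_hom_P1_unique:
  assumes f: "module_hom P1 N f" and g: "module_hom P1 N g"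
    and eq: "f V1 (unit_vec 0) = g V1 (unit_vec 0)" and v: "v \<in> space P1 x"
  shows "f x v = g x v"
proof -
  have e: "unit_vec 0 \<in> space P1 V1" "unit_vec 0 \<in> space P1 V2"
      "unit_vec 0 \<in> space P1 V3" "unit_vec 1 \<in> space P1 V3"
    by (simp_all add: space_P1 fvec.span_base)
  have h: "h V2 (unit_vec 0) = act N Alpha (h V1 (unit_vec 0))"
    "h V3 (unit_vec 0) = act N Beta (h V2 (unit_vec 0))"
    "h V3 (unit_vec 1) = act N Gamma (h V2 (unit_vec 0))"
    if "module_hom P1 N h" for h
  proof -
    have c: "h (tgt a) (P1_act a w) = act N a (h (src a) w)" if "w \<in> space P1 (src a)" for a w
      using \<open>module_hom P1 N h\<close> that unfolding module_hom_def act_P1 by blast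
    show "h V2 (unit_vec 0) = act N Alpha (h V1 (unit_vec 0))" using c[of "unit_vec 0" Alpha] e by simp
    show "h V3 (unit_vec 0) = act N Beta (h V2 (unit_vec 0))" using c[of "unit_vec 0" Beta] e by simp
    show "h V3 (unit_vec 1) = act N Gamma (h V2 (unit_vec 0))"
      using c[of "unit_vec 0" Gamma] e by (simp add: P1_act_Gamma_unit_vec del: P1_act.simps(3))
  qed
  have lin: "h y (p + q) = h y p + h y q" "h y (fscale k p) = fscale k (h y p)"
    if "module_hom P1 N h" "p \<in> space P1 y" "q \<in> space P1 y" for h y p q k
    using that unfolding module_hom_def linear_map_def by blast+
  have eqs: "f V2 (unit_vec 0) = g V2 (unit_vec 0)" "f V3 (unit_vec 0) = g V3 (unit_vec 0)"
    "f V3 (unit_vec 1) = g V3 (unit_vec 1)"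
    using h[OF f] h[OF g] eq by simp_all
  have sc: "fscale k p \<in> space P1 y" if "p \<in> space P1 y" for k p y
    using fvec.subspace_scale[OF is_module_subspace[OF is_module_P1] that] .
  show ?thesis
  proof (cases "x = V3")
    case False
    note dec = in_P1_coordinates(1)[OF v False]
    have ex: "unit_vec 0 \<in> space P1 x" "f x (unit_vec 0) = g x (unit_vec 0)"
      using False e eq eqs by (cases x; simp)+
    have "f x v = fscale (v 0) (f x (unit_vec 0))"
      by (subst dec) (rule lin(2)[OF f ex(1) ex(1)])
    also have "\<dots> = g x v"
      unfolding ex(2) by (subst (2) dec) (rule lin(2)[OF g ex(1) ex(1), symmetric])
    finally show ?thesis .
  next
    case True
    note dec = in_P1_coordinates(2)[OF v True]
    have exp: "h V3 v = fscale (v 0) (h V3 (unit_vec 0)) + fscale (v 1) (h V3 (unit_vec 1))"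
      if "module_hom P1 N h" for h
      by (subst dec) (simp only: lin[OF that sc[OF e(3)] sc[OF e(4)]] lin(2)[OF that e(3) e(3)] lin(2)[OF that e(4) e(4)])
    show ?thesis using exp[OF f] exp[OF g] eqs True by simp
  qed
qed

lemma module_hom_comp:
  assumes "is_module P" "module_hom P M h" "module_hom M N g"
  shows "module_hom P N (\<lambda>x v. g x (h x v))"
  using assms act_closed[OF assms(1)] unfolding module_hom_def linear_map_def by metis

text \<open>Choose a preimage \<open>m\<close> of the image of the generator. The homomorphism
  determined by \<open>m\<close> lifts \<open>f\<close>, because both sides agree on the
  generator.\<close>

lemma projective_P1: "projective (P1 :: 'k::field rep)"
  unfolding projective_def
proof (intro conjI allI impI is_module_P1)
  fix M N :: "'k rep" and g f
  assume M: "is_module M" and N: "is_module N" and g: "module_hom M N g"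
    and surj: "\<forall>x. g x ` space M x = space N x" and f: "module_hom P1 N f"
  have "f V1 (unit_vec 0) \<in> space N V1"
    using f unit_vec_in_P1 unfolding module_hom_def linear_map_def by blast
  then obtain m where m: "m \<in> space M V1" "g V1 m = f V1 (unit_vec 0)" using surj by (metis imageE)
  have "fscale (unit_vec 0 0) m = m" by (simp add: unit_vec_def)
  hence "g V1 (P1_hom M m V1 (unit_vec 0)) = f V1 (unit_vec 0)" using m(2) by simp
  hence "g x (P1_hom M m x v) = f x v" if "v \<in> space P1 x" for x v
    using module_hom_P1_unique[OF module_hom_comp[OF is_module_P1 module_hom_P1_hom[OF M m(1)] g] f _ that]
    by simp
  thus "\<exists>h. module_hom P1 M h \<and> (\<forall>x. \<forall>v\<in>space P1 x. g x (h x v) = f x v)"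
    using module_hom_P1_hom[OF M m(1)] by blast
qed

text \<open>A submodule that is nonzero at vertex 1 contains the generator and is all of
  \<open>P1\<close>, of length 4. An indecomposable one that vanishes there has no eigenvectors and
  dimension at most 1 at vertex 2, hence length 1 or 3.\<close>

lemma gr_measure_P1: "gr_measure (P1 :: 'k::alg_closed_field rep) = {1, 3, 4}"
proof (rule gr_measure_eqI[OF indecomposable_P1])
  show "{1, 3, 4} \<in> chain_length_sets (P1 :: 'k rep)"
    by (rule chain_one_three_four[OF is_module_P1 eigenvector_free_P1 unit_vec_in_P1])
      (simp add: act_P1 unit_vec_neq_0)
  show "J \<subseteq> {1, 3, 4}" if J: "J \<in> chain_length_sets (P1 :: 'k rep)" for J
  proof
    fix n assume "n \<in> J"
    then obtain N :: "'k rep" where N: "submodule N P1" "indecomposable N" "n = total_dim N"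
      using J by (meson chain_length_sets_elem)
    have Nmod: "is_module N" using N(1) by (rule submodule_is_module)
    show "n \<in> {1, 3, 4}"
    proof (cases "space N V1 = {0}")
      case True
      have "eigenvector_free N"
        using eigenvector_free_P1 submodule_subset[OF N(1), of V2] submodule_act[OF N(1)]
        unfolding eigenvector_free_def by (metis subsetD)
      hence "fvec.dim (space N V3) = Suc (fvec.dim (space N V2))"
        using eigenvector_free_structure[OF N(2) True] by blast
      moreover have "fvec.dim (space N V2) \<le> 1"
        using dim_submodule_le[OF N(1) is_module_P1, of V2] dim_vector_P1[where 'k = 'k]
        by (simp add: dim_vector_def)
      ultimately show ?thesis using N(3) True by (auto simp: total_dim_def dim_zero le_Suc_eq)
    next
      case False
      then obtain w where w: "w \<in> space N V1" "w \<noteq> 0" using is_module_zero[OF Nmod, of V1] by blast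
      have dec: "w = fscale (w 0) (unit_vec 0)"
        using in_P1_coordinates(1)[of w V1] w(1) submodule_subset[OF N(1), of V1] by blast
      hence "w 0 \<noteq> 0" using w(2) by (metis fvec.scale_zero_left)
      have "fscale (inverse (w 0)) w = unit_vec 0"
        by (subst dec) (simp add: fvec.scale_scale \<open>w 0 \<noteq> 0\<close>)
      hence "unit_vec 0 \<in> space N V1"
        using fvec.subspace_scale[OF is_module_subspace[OF Nmod] w(1)] by metis
      hence "gen_space P1 V1 (unit_vec 0) x \<subseteq> space N x" for x
        using gen_space_minimal[OF Nmod _ submodule_act[OF N(1)]] by blast
      moreover have "gen_space P1 V1 (unit_vec 0) x = space (P1 :: 'k rep) x" for x
        using P1_generated[where 'a = 'k] space_gen by metis
      ultimately have "space N x = space P1 x" for x using submodule_subset[OF N(1), of x] by blast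
      thus ?thesis using N(3) total_dim_P1[where 'k = 'k] by (simp add: total_dim_def)
    qed
  qed
qed

section \<open>The measures below the measure of the projective module\<close>

lemma preprojective_measure_less:
  "gr_less (preprojective_measure n) (preprojective_measure (Suc n))"
proof (rule gr_less_subset)
  have "2 * n + 3 \<notin> preprojective_measure n" by (auto simp: preprojective_measure_def)
  thus "preprojective_measure n \<subset> preprojective_measure (Suc n)"
    unfolding preprojective_measure_Suc by blast
qed

text \<open>For positive \<open>n\<close> both sets contain 1 and 3 but not 0 or 2, and the even
  number 4 decides. For \<open>n = 0\<close> the left side is a proper subset.\<close>

lemma preprojective_measure_less_P1: "gr_less (preprojective_measure n) {1, 3, 4}"
proof (cases n)
  case 0
  thus ?thesis by (intro gr_less_subset) (auto simp: preprojective_measure_0)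
next
  case (Suc m)
  have even: "k \<notin> preprojective_measure n" if "even k" for k
    using that unfolding preprojective_measure_def by auto
  have "4 \<notin> preprojective_measure n" by (rule even) simp
  moreover have "k \<in> preprojective_measure n \<longleftrightarrow> k \<in> {1, 3, 4}" if "k < 4" for k
  proof -
    have "k = 0 \<or> k = 1 \<or> k = 2 \<or> k = 3" using that by auto
    moreover have "0 \<notin> preprojective_measure n" "2 \<notin> preprojective_measure n"
      by (simp_all add: even)
    moreover have "2 * 0 + 1 \<in> preprojective_measure n" "2 * 1 + 1 \<in> preprojective_measure n"
      using Suc unfolding preprojective_measure_def by (blast, intro imageI, simp)
    ultimately show ?thesis by auto
  qed
  ultimately show ?thesis unfolding gr_less_iff by (intro bexI[of _ 4]) auto
qed

lemma P1_measure_less_one_two: "gr_less {1, 3, 4} {1, 2}"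
  unfolding gr_less_iff by (intro bexI[of _ 2]) (auto simp: less_Suc_eq numeral_2_eq_2)

text \<open>All simple modules have measure {1}, the smallest of the preprojective ones. The two
  cases with an explicit chain need only a lower bound, since the measure is the maximum over all
  chains.\<close>

lemma gr_measure_trichotomy:
  fixes M :: "'k::alg_closed_field rep"
  assumes "indecomposable M"
  shows "gr_measure M \<in> range preprojective_measure \<or> gr_measure M = {1, 3, 4} \<or> gr_less {1, 3, 4} (gr_measure M)"
  using assms
proof (cases rule: indecomposable_cases)
  case 1
  have "gr_measure M = {1}"
  proof (rule gr_measure_eqI[OF assms])
    show "{1} \<in> chain_length_sets M" using chain_length_sets_singleton[OF assms] 1 by simp
    show "J \<subseteq> {1}" if J: "J \<in> chain_length_sets M" for J
    proof
      fix n assume "n \<in> J"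
      then obtain N where N: "submodule N M" "indecomposable N" "n = total_dim N"
        using J by (meson chain_length_sets_elem)
      have "total_dim N \<le> 1"
        using total_dim_submodule_le[OF N(1) indecomposable_is_module[OF assms]] 1 by simp
      moreover have "total_dim N \<noteq> 0"
        using N(2) total_dim_eq_0[OF indecomposable_is_module[OF N(2)]] by (simp add: indecomposable_def)
      ultimately show "n \<in> {1}" using N(3) by simp
    qed
  qed
  thus ?thesis using preprojective_measure_0 by (metis rangeI)
next
  case 2
  thus ?thesis using gr_measure_greatest(2)[OF assms] P1_measure_less_one_two gr_less_trans by metis
next
  case 3
  thus ?thesis using gr_measure_greatest(2)[OF assms] by metis
next
  case 4
  thus ?thesis using gr_measure_eigenvector_free[OF assms] by blast
qed

section \<open>The take-off measures, and a criterion against landing measures\<close>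

lemma gr_measures_P1: "{1, 3, 4} \<in> gr_measures TYPE('k::alg_closed_field)"
  unfolding gr_measures_def using indecomposable_P1[where 'a = 'k] gr_measure_P1[where 'k = 'k] by blast

lemma gr_measures_preprojective: "preprojective_measure n \<in> gr_measures TYPE('k::alg_closed_field)"
  unfolding gr_measures_def
  using indecomposable_preprojective[of n, where 'k = 'k] gr_measure_preprojective[of n, where 'k = 'k] by blast

lemma gr_measures_cases:
  assumes "I \<in> gr_measures TYPE('k::alg_closed_field)"
  shows "I \<in> range preprojective_measure \<or> I = {1, 3, 4} \<or> gr_less {1, 3, 4} I"
  using assms gr_measure_trichotomy unfolding gr_measures_def by blast

lemma take_off_sequence_preprojective:
  "take_off_sequence TYPE('k::alg_closed_field) preprojective_measure"
  unfolding take_off_sequence_def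
proof (intro conjI allI ballI impI)
  show "preprojective_measure i \<in> gr_measures TYPE('k)" for i by (rule gr_measures_preprojective)
  show "gr_less (preprojective_measure i) (preprojective_measure (Suc i))" for i
    by (rule preprojective_measure_less)
  show "gr_less (preprojective_measure i) I"
    if "I \<in> gr_measures TYPE('k)" "I \<notin> range preprojective_measure" for I i
    using gr_measures_cases[OF that(1)] that(2) preprojective_measure_less_P1[of i] gr_less_trans by metis
qed

lemma take_off_measure_iff:
  "take_off_measure TYPE('k::alg_closed_field) I \<longleftrightarrow> I \<in> range preprojective_measure"
  unfolding take_off_measure_def
  using take_off_sequence_preprojective[where 'k = 'k] take_off_sequence_range_unique by metis

lemma gr_measure_subset:
  assumes "indecomposable M"
  shows "gr_measure M \<subseteq> {..total_dim M}"
proof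
  fix n assume "n \<in> gr_measure M"
  then obtain N where "submodule N M" "n = total_dim N"
    using gr_measure_greatest(1)[OF assms] by (meson chain_length_sets_elem)
  thus "n \<in> {..total_dim M}"
    using total_dim_submodule_le indecomposable_is_module[OF assms] by simp
qed

text \<open>The measures of the regular modules need not be known. Each is a finite set containing
  the length \<open>2 * Suc n\<close> of its module, and finitely many finite sets cannot contain
  all these lengths.\<close>

lemma infinitely_many_above_P1:
  "infinite {I \<in> gr_measures TYPE('k::alg_closed_field). gr_less {1, 3, 4} I}" (is "infinite ?A")
proof
  assume fin: "finite ?A"
  let ?R = "\<lambda>n. regular (Suc n) :: 'k rep"
  have ind: "indecomposable (?R n)" for n by (rule indecomposable_regular) simp
  have A: "gr_measure (?R n) \<in> ?A" for n
  proof -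
    have "gr_measure (?R n) \<in> gr_measures TYPE('k)"
      unfolding gr_measures_def by (rule CollectI, rule exI[of _ "?R n"], rule conjI[OF refl ind])
    moreover
    have "{1, 2} = gr_measure (?R n) \<or> gr_less {1, 2} (gr_measure (?R n))"
      by (rule gr_measure_greatest(2)[OF ind chain_one_two_regular]) simp
    hence "gr_less {1, 3, 4} (gr_measure (?R n))"
      using P1_measure_less_one_two gr_less_trans by metis
    ultimately show ?thesis by simp
  qed
  have "finite (\<Union>n. gr_measure (?R n))"
  proof -
    have "finite (range (\<lambda>n. gr_measure (?R n)))"
      by (rule finite_subset[OF _ fin]) (use A in \<open>rule image_subsetI\<close>)
    moreover have "finite (gr_measure (?R n))" for n
      using gr_measure_subset[OF ind] by (rule finite_subset) simp
    ultimately show ?thesis by (intro finite_Union) auto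
  qed
  moreover have "2 * Suc n \<in> (\<Union>n. gr_measure (?R n))" for n
    using total_dim_in_gr_measure[OF ind[of n]] unfolding total_dim_regular by blast
  hence "range (\<lambda>n. 2 * Suc n) \<subseteq> (\<Union>n. gr_measure (?R n))" by blast
  ultimately have "finite (range (\<lambda>n. 2 * Suc n))" by (rule finite_subset[rotated])
  moreover have "inj (\<lambda>n. 2 * Suc n)" by (rule injI) simp
  ultimately show False using finite_imageD by blast
qed

text \<open>Everything above \<open>hi j\<close> belongs to the sequence, and since the sequence
  decreases it occurs before position \<open>j\<close>. This excludes a landing measure without any
  knowledge of the landing sequence.\<close>

lemma finitely_many_above_landing:
  assumes "landing_measure K I"
  shows "finite {J \<in> gr_measures K. gr_less I J}"
proof -
  obtain hi j where hi: "landing_sequence K hi" "I = hi j"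
    using assms unfolding landing_measure_def by blast
  have step: "gr_less (hi (Suc i)) (hi i)" for i
    using hi(1) by (simp add: landing_sequence_def)
  have down: "gr_less (hi (Suc (i + d))) (hi i)" for i d
  proof (induction d)
    case 0
    show ?case using step[of i] by simp
  next
    case (Suc d)
    show ?case using gr_less_trans[OF step[of "Suc (i + d)"] Suc] by simp
  qed
  have "J \<in> hi ` {..<j}" if J: "J \<in> gr_measures K" "gr_less I J" for J
  proof -
    have "J \<in> range hi"
    proof (rule ccontr)
      assume "J \<notin> range hi"
      hence "gr_less J I" using hi J(1) by (simp add: landing_sequence_def)
      thus False using J(2) gr_less_trans gr_less_irrefl by metis
    qed
    then obtain l where l: "J = hi l" by blast
    have "l < j"
    proof (rule ccontr)
      assume "\<not> l < j"
      hence "l = j \<or> (\<exists>d. l = Suc (j + d))" using less_iff_Suc_add[of j l] by auto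
      hence "J = I \<or> gr_less J I" using l hi(2) down by auto
      thus False using J(2) gr_less_trans gr_less_irrefl by metis
    qed
    thus ?thesis using l by blast
  qed
  hence "{J \<in> gr_measures K. gr_less I J} \<subseteq> hi ` {..<j}" by blast
  thus ?thesis by (rule finite_subset) simp
qed

lemma central_measure_P1: "central_measure TYPE('k::alg_closed_field) {1, 3, 4}"
proof -
  have "{1, 3, 4} \<notin> range preprojective_measure"
    using preprojective_measure_less_P1 gr_less_irrefl by (metis imageE)
  thus ?thesis
    unfolding central_measure_def take_off_measure_iff
    using gr_measures_P1 finitely_many_above_landing infinitely_many_above_P1 by blast
qed

theorem proposition3p4:
  shows "indecomposable (P1 :: 'k::alg_closed_field rep) \<and>
    projective (P1 :: 'k rep) \<and>
    dim_vector (P1 :: 'k rep) = (1, 1, 2) \<and>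
    central_module (P1 :: 'k rep) \<and>
    (\<forall>I. central_measure TYPE('k) I \<longrightarrow>
      I = gr_measure (P1 :: 'k rep) \<or> gr_less (gr_measure (P1 :: 'k rep)) I) \<and>
    \<not> (\<exists>I. direct_predecessor TYPE('k) I (gr_measure (P1 :: 'k rep)))"
proof (intro conjI allI impI)
  show "indecomposable (P1 :: 'k rep)" by (rule indecomposable_P1)
  show "projective (P1 :: 'k rep)" by (rule projective_P1)
  show "dim_vector (P1 :: 'k rep) = (1, 1, 2)" by (rule dim_vector_P1)
  show "central_module (P1 :: 'k rep)"
    unfolding central_module_def gr_measure_P1 using indecomposable_P1 central_measure_P1 by blast
  show "I = gr_measure (P1 :: 'k rep) \<or> gr_less (gr_measure (P1 :: 'k rep)) I"
    if "central_measure TYPE('k) I" for I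
    using that gr_measures_cases[of I, where 'k = 'k]
    unfolding gr_measure_P1 central_measure_def take_off_measure_iff by blast
  show "\<not> (\<exists>I. direct_predecessor TYPE('k) I (gr_measure (P1 :: 'k rep)))"
  proof
    assume "\<exists>I. direct_predecessor TYPE('k) I (gr_measure (P1 :: 'k rep))"
    then obtain I where I: "I \<in> gr_measures TYPE('k)" "gr_less I {1, 3, 4}"
      "\<not> (\<exists>L\<in>gr_measures TYPE('k). gr_less I L \<and> gr_less L {1, 3, 4})"
      unfolding direct_predecessor_def gr_measure_P1 by blast
    \<comment> \<open>Only preprojective measures lie below {1, 3, 4}, and each is followed by a
      larger one still below.\<close>
    have "I \<in> range preprojective_measure"
      using gr_measures_cases[OF I(1)] I(2) gr_less_irrefl gr_less_trans by metis
    then obtain n where "I = preprojective_measure n" by blast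
    thus False
      using I(3) preprojective_measure_less[of n] preprojective_measure_less_P1[of "Suc n"]
        gr_measures_preprojective[of "Suc n", where 'k = 'k] by blast
  qed
qed

end
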